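(* Let $R$ be one of the chain rings $\mathbb{G}_4=\mathbb{Z}_4[X]/(X^2+X+1)$, $\mathbb{S}_4=\mathbb{F}_4[X]/(X^2)$, $\mathbb{T}_4=\mathbb{F}_4[X;a\mapsto a^2]/(X^2)$. Then $\mathrm{m}_7(R)\le 101$.
   Context: $\mathbb{F}_4[X;a\mapsto a^2]$ denotes the skew polynomial ring with commutation rule $Xa=a^2X$. For a finite chain ring $R$ of length $2$ with residue field $\mathbb{F}_q$, the projective Hjelmslev plane $\mathrm{PHG}(2,R)$ is the incidence structure whose points are the free rank-$1$ submodules of the right module $R_R^3$, whose lines are the free rank-$2$ submodules of $R_R^3$, with incidence given by inclusion. A projective $(k,n)$-arc is a set of $k$ points meeting every line in at most $n$ points. For $0\le n\le q^2+q$, $\mathrm{m}_n(R)$ denotes the largest $k$ such that a projective $(k,n)$-arc exists in $\mathrm{PHG}(2,R)$. *)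

theory Defs
  imports "HOL-Algebra.Ring"
begin

definition vecs :: "('a, 'b) ring_scheme \<Rightarrow> ('a \<times> 'a \<times> 'a) set" where
  "vecs R = carrier R \<times> carrier R \<times> carrier R"

definition vsmul :: "('a, 'b) ring_scheme \<Rightarrow> 'a \<times> 'a \<times> 'a \<Rightarrow> 'a \<Rightarrow> 'a \<times> 'a \<times> 'a" where
  "vsmul R x r = (case x of (x1, x2, x3) \<Rightarrow>
     (x1 \<otimes>\<^bsub>R\<^esub> r, x2 \<otimes>\<^bsub>R\<^esub> r, x3 \<otimes>\<^bsub>R\<^esub> r))"

definition vadd :: "('a, 'b) ring_scheme \<Rightarrow> 'a \<times> 'a \<times> 'a \<Rightarrow> 'a \<times> 'a \<times> 'a \<Rightarrow> 'a \<times> 'a \<times> 'a" where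
  "vadd R x y = (case x of (x1, x2, x3) \<Rightarrow> case y of (y1, y2, y3) \<Rightarrow>
     (x1 \<oplus>\<^bsub>R\<^esub> y1, x2 \<oplus>\<^bsub>R\<^esub> y2, x3 \<oplus>\<^bsub>R\<^esub> y3))"

definition vzero :: "('a, 'b) ring_scheme \<Rightarrow> 'a \<times> 'a \<times> 'a" where
  "vzero R = (\<zero>\<^bsub>R\<^esub>, \<zero>\<^bsub>R\<^esub>, \<zero>\<^bsub>R\<^esub>)"

text \<open>Points: free rank-1 submodules of R_R^3, i.e. submodules x R having a one-element
  basis x (x r = 0 implies r = 0).\<close>
definition hpoints :: "('a, 'b) ring_scheme \<Rightarrow> ('a \<times> 'a \<times> 'a) set set" where
  "hpoints R = {S. \<exists>x\<in>vecs R.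
     S = {vsmul R x r | r. r \<in> carrier R} \<and>
     (\<forall>r\<in>carrier R. vsmul R x r = vzero R \<longrightarrow> r = \<zero>\<^bsub>R\<^esub>)}"

text \<open>Lines: free rank-2 submodules of R_R^3, i.e. submodules x R + y R having a
  two-element basis x, y.\<close>
definition hlines :: "('a, 'b) ring_scheme \<Rightarrow> ('a \<times> 'a \<times> 'a) set set" where
  "hlines R = {S. \<exists>x\<in>vecs R. \<exists>y\<in>vecs R.
     S = {vadd R (vsmul R x r) (vsmul R y s) | r s. r \<in> carrier R \<and> s \<in> carrier R} \<and>
     (\<forall>r\<in>carrier R. \<forall>s\<in>carrier R.
        vadd R (vsmul R x r) (vsmul R y s) = vzero R \<longrightarrow> r = \<zero>\<^bsub>R\<^esub> \<and> s = \<zero>\<^bsub>R\<^esub>)}"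

definition proj_arc :: "('a, 'b) ring_scheme \<Rightarrow> ('a \<times> 'a \<times> 'a) set set \<Rightarrow> nat \<Rightarrow> nat \<Rightarrow> bool" where
  "proj_arc R K k n \<longleftrightarrow> K \<subseteq> hpoints R \<and> card K = k \<and>
     (\<forall>L\<in>hlines R. card {P\<in>K. P \<subseteq> L} \<le> n)"

definition max_arc :: "nat \<Rightarrow> ('a, 'b) ring_scheme \<Rightarrow> nat" where
  "max_arc n R = Max {k. \<exists>K. proj_arc R K k n}"

text \<open>F_4 = F_2[w]/(w^2+w+1); element (a0,a1) stands for a0 + a1 w, with a0,a1 in {0,1}.\<close>
definition f4_add :: "int \<times> int \<Rightarrow> int \<times> int \<Rightarrow> int \<times> int" where
  "f4_add a b = ((fst a + fst b) mod 2, (snd a + snd b) mod 2)"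

definition f4_mul :: "int \<times> int \<Rightarrow> int \<times> int \<Rightarrow> int \<times> int" where
  "f4_mul a b = ((fst a * fst b + snd a * snd b) mod 2,
                 (fst a * snd b + snd a * fst b + snd a * snd b) mod 2)"

definition F4 :: "(int \<times> int) set" where
  "F4 = {0, 1} \<times> {0, 1}"

text \<open>G_4 = Z_4[X]/(X^2+X+1): element (a,b) stands for a + b \<omega> with \<omega>^2 = -\<omega> - 1, a,b in Z_4.\<close>
definition G4 :: "(int \<times> int) ring" where
  "G4 = \<lparr>carrier = {0..3} \<times> {0..3},
         mult = (\<lambda>x y. ((fst x * fst y - snd x * snd y) mod 4,
                        (fst x * snd y + snd x * fst y - snd x * snd y) mod 4)),
         one = (1, 0),
         zero = (0, 0),
         add = (\<lambda>x y. ((fst x + fst y) mod 4, (snd x + snd y) mod 4))\<rparr>"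

text \<open>S_4 = F_4[X]/(X^2): element (a,b) stands for a + b X, a,b in F_4.\<close>
definition S4 :: "((int \<times> int) \<times> (int \<times> int)) ring" where
  "S4 = \<lparr>carrier = F4 \<times> F4,
         mult = (\<lambda>x y. (f4_mul (fst x) (fst y),
                        f4_add (f4_mul (fst x) (snd y)) (f4_mul (snd x) (fst y)))),
         one = ((1, 0), (0, 0)),
         zero = ((0, 0), (0, 0)),
         add = (\<lambda>x y. (f4_add (fst x) (fst y), f4_add (snd x) (snd y)))\<rparr>"

text \<open>T_4 = F_4[X; a \<mapsto> a^2]/(X^2) with X a = a^2 X: element (a,b) stands for a + b X, so
  (a + bX)(c + dX) = ac + (ad + b c^2) X.\<close>
definition T4 :: "((int \<times> int) \<times> (int \<times> int)) ring" where
  "T4 = \<lparr>carrier = F4 \<times> F4,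
         mult = (\<lambda>x y. (f4_mul (fst x) (fst y),
                        f4_add (f4_mul (fst x) (snd y))
                               (f4_mul (snd x) (f4_mul (fst y) (fst y))))),
         one = ((1, 0), (0, 0)),
         zero = ((0, 0), (0, 0)),
         add = (\<lambda>x y. (f4_add (fst x) (fst y), f4_add (snd x) (snd y)))\<rparr>"

end

theory Submission
  imports Defs "HOL-Library.Cardinality"
begin

text \<open>Suppose an arc of 102 points exists. Let \<open>u\<close> be the number of its points in a neighbour class of
  points and \<open>T\<close> the number in a neighbour class of lines. The four lines through a segment with \<open>i\<close> arc
  points of a class in \<open>l\<close> partition the rest of \<open>l\<close>, so \<open>T \<le> u + 4 (7 - i)\<close>; the values \<open>T\<close> of the five
  line classes through a point class sum to \<open>102 + 4 u\<close>; and a class is an affine plane of order 4, which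
  relates its segment sizes in the five directions by counting pairs. Together these give \<open>u \<le> 6\<close>, and
  determine the segment sizes when \<open>u = 5\<close> (2,2,1,0 in every direction) and \<open>u = 6\<close> (2,2,2,0 in every
  direction, or else all estimates are tight; call such a class special).

  Without classes of six, some line class would consist of five classes of five points, which a second
  moment count excludes. Every class of six lies in a line class with \<open>T = 26\<close>, and at most one class of
  such a line class is of type 2,2,2,0. Double counting shows that all classes of six are special, that
  \<open>n\<close> of them lie on \<open>n\<close> line classes with \<open>T = 26\<close>, and that \<open>n \<in> {13, 14, 15}\<close>. The first two values
  contradict the number 21 of line classes and the sum of all \<open>T\<close>; for \<open>n = 15\<close> there is a line class
  with \<open>T = 22\<close> made of three special classes and two classes of two points, which is impossible.\<close>

section \<open>The projective plane of order 4\<close>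

text \<open>\<open>GW\<close> is a root w of X^2 + X + 1 and \<open>GV\<close> is w + 1 = w^2. A
  plain datatype makes identities finite case checks and lets \<open>code_simp\<close> run the
  searches below.\<close>

datatype gf4 = G0 | G1 | GW | GV

lemma UNIV_gf4: "(UNIV :: gf4 set) = {G0, G1, GW, GV}"
  using gf4.exhaust by blast

instance gf4 :: finite
  by standard (simp add: UNIV_gf4)

instantiation gf4 :: comm_ring_1
begin
definition zero_gf4 :: gf4 where "zero_gf4 = G0"
definition one_gf4 :: gf4 where "one_gf4 = G1"
fun plus_gf4 :: "gf4 \<Rightarrow> gf4 \<Rightarrow> gf4" where
  "plus_gf4 G0 b = b"
| "plus_gf4 a G0 = a"
| "plus_gf4 G1 G1 = G0"
| "plus_gf4 G1 GW = GV"
| "plus_gf4 G1 GV = GW"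
| "plus_gf4 GW G1 = GV"
| "plus_gf4 GW GW = G0"
| "plus_gf4 GW GV = G1"
| "plus_gf4 GV G1 = GW"
| "plus_gf4 GV GW = G1"
| "plus_gf4 GV GV = G0"
fun times_gf4 :: "gf4 \<Rightarrow> gf4 \<Rightarrow> gf4" where
  "times_gf4 G0 b = G0"
| "times_gf4 G1 b = b"
| "times_gf4 GW G0 = G0"
| "times_gf4 GW G1 = GW"
| "times_gf4 GW GW = GV"
| "times_gf4 GW GV = G1"
| "times_gf4 GV G0 = G0"
| "times_gf4 GV G1 = GV"
| "times_gf4 GV GW = G1"
| "times_gf4 GV GV = GW"
definition uminus_gf4 :: "gf4 \<Rightarrow> gf4" where "uminus_gf4 a = a"
definition minus_gf4 :: "gf4 \<Rightarrow> gf4 \<Rightarrow> gf4" where "minus_gf4 a b = a + b"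
instance
proof
  fix a b c :: gf4
  show "a * b * c = a * (b * c)" by (cases a; cases b; cases c) simp_all
  show "a * b = b * a" by (cases a; cases b) simp_all
  show "1 * a = a" by (simp add: one_gf4_def)
  show "a + b + c = a + (b + c)" by (cases a; cases b; cases c) simp_all
  show "a + b = b + a" by (cases a; cases b) simp_all
  show "0 + a = a" by (simp add: zero_gf4_def)
  show "- a + a = 0" by (cases a) (simp_all add: uminus_gf4_def zero_gf4_def)
  show "a - b = a + - b" by (simp add: uminus_gf4_def minus_gf4_def)
  show "(a + b) * c = a * c + b * c" by (cases a; cases b; cases c) simp_all
  show "(0::gf4) \<noteq> 1" by (simp add: zero_gf4_def one_gf4_def)
qed
end

lemma gf4_add_self [simp]: "(a::gf4) + a = 0"
  by (cases a) (simp_all add: zero_gf4_def)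

lemma gf4_add_eq_0_iff: "(a::gf4) + b = 0 \<longleftrightarrow> a = b"
  by (metis add_right_cancel gf4_add_self)

lemma gf4_inverse_exists: "a \<noteq> 0 \<Longrightarrow> \<exists>b::gf4. a * b = 1"
  by (cases a) (auto simp: zero_gf4_def one_gf4_def intro: exI[of _ G1] exI[of _ GW] exI[of _ GV])

text \<open>Normalised vectors, with first nonzero coordinate 1. The same type serves for points
  and, as coefficient vectors of equations, for lines.\<close>

datatype pg = P1 gf4 gf4 | P2 gf4 | P3

fun coords :: "pg \<Rightarrow> gf4 \<times> gf4 \<times> gf4" where
  "coords (P1 p q) = (1, p, q)"
| "coords (P2 q) = (0, 1, q)"
| "coords P3 = (0, 0, 1)"

text \<open>The pivot of a normalised vector is its first nonzero coordinate; the lifts of a point to a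
  chain ring of length 2 that keep the pivot equal to 1 differ by vectors vanishing at the pivot.\<close>

fun offpivot :: "pg \<Rightarrow> gf4 \<times> gf4 \<Rightarrow> gf4 \<times> gf4 \<times> gf4" where
  "offpivot (P1 p q) (e, e') = (0, e, e')"
| "offpivot (P2 q) (e, e') = (e, 0, e')"
| "offpivot P3 (e, e') = (e, e', 0)"

fun dot :: "gf4 \<times> gf4 \<times> gf4 \<Rightarrow> gf4 \<times> gf4 \<times> gf4 \<Rightarrow> gf4" where
  "dot (a, b, c) (x, y, z) = a * x + b * y + c * z"

definition pg_inc :: "pg \<Rightarrow> pg \<Rightarrow> bool" where
  "pg_inc x a \<longleftrightarrow> dot (coords a) (coords x) = 0"

section \<open>Exhaustive verification in the plane of order 4\<close>

definition gf4_list :: "gf4 list" where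
  "gf4_list = [G0, G1, GW, GV]"

definition pg_list :: "pg list" where
  "pg_list = P3 # map P2 gf4_list @ concat (map (\<lambda>p. map (P1 p) gf4_list) gf4_list)"

lemma set_gf4_list: "set gf4_list = UNIV"
  by (simp add: gf4_list_def UNIV_gf4)

lemma set_pg_list: "set pg_list = UNIV"
proof -
  have "x \<in> set pg_list" for x
    using set_gf4_list by (cases x) (auto simp: pg_list_def)
  then show ?thesis by blast
qed

lemma distinct_pg_list: "distinct pg_list"
  by code_simp

instance pg :: finite
  by standard (metis List.finite_set set_pg_list)

lemma card_pg_Collect: "card {x. P x} = length (filter P pg_list)"
proof -
  have "{x. P x} = set (filter P pg_list)"
    by (simp add: set_pg_list)
  then show ?thesis
    using distinct_card[of "filter P pg_list"] distinct_pg_list by simp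
qed

lemma all_pg_iff: "(\<forall>x. P x) \<longleftrightarrow> list_all P pg_list"
  by (simp add: list_all_iff set_pg_list)

lemma all_gf4_iff: "(\<forall>x. P x) \<longleftrightarrow> list_all P gf4_list"
  by (simp add: list_all_iff set_gf4_list)

lemma card_gf4: "card (UNIV :: gf4 set) = 4"
  by (simp add: UNIV_gf4)

lemma card_pg: "card (UNIV :: pg set) = 21"
proof -
  have "length (filter (\<lambda>_. True) pg_list) = 21"
    by code_simp
  then show ?thesis
    using card_pg_Collect[of "\<lambda>_. True"] by simp
qed

lemma card_pg_lines_on: "card {a. pg_inc x a} = 5"
proof -
  have "\<forall>x. length (filter (pg_inc x) pg_list) = 5"
    unfolding all_pg_iff by code_simp
  then show ?thesis
    by (simp add: card_pg_Collect)
qed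

lemma card_pg_points_on: "card {x. pg_inc x a} = 5"
proof -
  have "\<forall>a. length (filter (\<lambda>x. pg_inc x a) pg_list) = 5"
    unfolding all_pg_iff by code_simp
  then show ?thesis
    by (simp add: card_pg_Collect)
qed

lemma pg_join:
  assumes "x \<noteq> y"
  shows "\<exists>!a. pg_inc x a \<and> pg_inc y a"
proof -
  have "\<forall>x. \<forall>y. x = y \<or> length (filter (\<lambda>a. pg_inc x a \<and> pg_inc y a) pg_list) = 1"
    unfolding all_pg_iff by code_simp
  then have "card {a. pg_inc x a \<and> pg_inc y a} = 1"
    unfolding card_pg_Collect using assms by blast
  then show ?thesis
    by (metis (no_types, lifting) card_1_singletonE mem_Collect_eq singletonD singletonI)
qed

text \<open>The lifts of \<open>x\<close> form an affine plane of order 4 whose directions are the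
  five lines through \<open>x\<close>; a nonzero displacement has one direction. Hence two points of
  a class share a segment in just one direction.\<close>

lemma pg_unique_direction:
  assumes "(e, e') \<noteq> (0, 0)"
  shows "card {a. pg_inc x a \<and> dot (coords a) (offpivot x (e, e')) = 0} = 1"
proof -
  have "\<forall>x. \<forall>e. \<forall>e'. (e, e') = (0, 0) \<or>
      length (filter (\<lambda>a. pg_inc x a \<and> dot (coords a) (offpivot x (e, e')) = 0) pg_list) = 1"
    unfolding all_pg_iff all_gf4_iff by code_simp
  then show ?thesis
    unfolding card_pg_Collect using assms by blast
qed

fun map3 :: "('a \<Rightarrow> 'b) \<Rightarrow> 'a \<times> 'a \<times> 'a \<Rightarrow> 'b \<times> 'b \<times> 'b" where
  "map3 f (a, b, c) = (f a, f b, f c)"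

text \<open>Two distinct lines of the class \<open>a\<close> differ by a nonzero
  \<open>(f, f')\<close> and share a segment in the class of \<open>x\<close> exactly where this
  form vanishes, so they agree on at most one point class. Both automorphisms of F_4 occur as the
  twist \<open>\<sigma>\<close>.\<close>

lemma pg_unique_twisted_zero:
  assumes "(f, f') \<noteq> (0, 0)" "\<sigma> = (\<lambda>a. a) \<or> \<sigma> = (\<lambda>a. a * a)"
    and "pg_inc x a" "dot (offpivot a (f, f')) (map3 \<sigma> (coords x)) = 0"
    and "pg_inc y a" "dot (offpivot a (f, f')) (map3 \<sigma> (coords y)) = 0"
  shows "x = y"
proof -
  have id: "\<forall>a. \<forall>f. \<forall>f'. (f, f') = (0, 0) \<or>
      length (filter (\<lambda>x. pg_inc x a \<and> dot (offpivot a (f, f')) (map3 (\<lambda>a. a) (coords x)) = 0)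
        pg_list) \<le> 1"
    unfolding all_pg_iff all_gf4_iff by code_simp
  have sq: "\<forall>a. \<forall>f. \<forall>f'. (f, f') = (0, 0) \<or>
      length (filter (\<lambda>x. pg_inc x a \<and> dot (offpivot a (f, f')) (map3 (\<lambda>a. a * a) (coords x)) = 0)
        pg_list) \<le> 1"
    unfolding all_pg_iff all_gf4_iff by code_simp
  from assms(2) have "card {x. pg_inc x a \<and> dot (offpivot a (f, f')) (map3 \<sigma> (coords x)) = 0} \<le> 1"
  proof
    assume s: "\<sigma> = (\<lambda>a. a)"
    show ?thesis
      unfolding s card_pg_Collect using id assms(1) by blast
  next
    assume s: "\<sigma> = (\<lambda>a. a * a)"
    show ?thesis
      unfolding s card_pg_Collect using sq assms(1) by blast
  qed
  then show ?thesis
    using assms(3-6) card_le_Suc0_iff_eq[of "{x. pg_inc x a \<and> dot (offpivot a (f, f')) (map3 \<sigma> (coords x)) = 0}"]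
    by simp
qed

lemma dot_offpivot_add:
  "dot v (offpivot x (e + d, e' + d')) = dot v (offpivot x (e, e')) + dot v (offpivot x (d, d'))"
  by (cases v; cases x) (simp_all add: algebra_simps)

lemma dot_commute: "dot v w = dot w v"
  by (cases v; cases w) (simp add: mult.commute)

section \<open>One neighbour class of lines\<close>

lemma four_elements:
  assumes "CARD('i::finite) = 4"
  obtains i0 i1 i2 i3 :: "'i::finite" where "UNIV = {i0, i1, i2, i3}" "distinct [i0, i1, i2, i3]"
proof -
  obtain xs :: "'i list" where xs: "set xs = UNIV" "distinct xs"
    using finite_distinct_list[of "UNIV :: 'i set"] by auto
  then have "length xs = 4"
    using assms by (metis distinct_card)
  then obtain a b d e where "xs = [a, b, d, e]"
    by (auto simp: numeral_eq_Suc length_Suc_conv)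
  with xs show thesis
    by (intro that[of a b d e]) auto
qed

lemma nat_le_2_cases: "(a::nat) \<le> 2 \<Longrightarrow> a = 0 \<or> a = 1 \<or> a = 2"
  and nat_le_3_cases: "(a::nat) \<le> 3 \<Longrightarrow> a = 0 \<or> a = 1 \<or> a = 2 \<or> a = 3"
  by auto

lemma sum_le_four_times:
  fixes c :: "'i::finite \<Rightarrow> nat"
  assumes "CARD('i) = 4" "\<And>i. c i \<le> m"
  shows "sum c UNIV \<le> 4 * m"
  using sum_bounded_above[of UNIV c m] assms by simp

lemma sum_fibres:
  fixes f :: "'j::finite \<Rightarrow> 'i::finite" and h :: "'j \<Rightarrow> nat"
  shows "(\<Sum>i\<in>UNIV. \<Sum>j | f j = i. h j) = sum h UNIV"
  using sum.group[of "UNIV :: 'j set" "UNIV :: 'i set" f h] by simp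

text \<open>The extreme patterns are 2210, 2220, 2221 and 2222; for sum 6 the only other pattern is
  2211, with square sum 10.\<close>

lemma sum_squares_max2:
  fixes c :: "'i::finite \<Rightarrow> nat"
  assumes "CARD('i) = 4" "\<And>i. c i \<le> 2"
  shows "sum c UNIV = 5 \<Longrightarrow> (\<Sum>i\<in>UNIV. (c i)\<^sup>2) \<le> 9"
    and "sum c UNIV = 6 \<Longrightarrow> (\<Sum>i\<in>UNIV. (c i)\<^sup>2) \<in> {10, 12}"
    and "sum c UNIV = 7 \<Longrightarrow> (\<Sum>i\<in>UNIV. (c i)\<^sup>2) \<le> 13"
    and "sum c UNIV = 8 \<Longrightarrow> (\<Sum>i\<in>UNIV. (c i)\<^sup>2) \<le> 16"
    and "sum c UNIV = 6 \<Longrightarrow> (\<Sum>i\<in>UNIV. (c i)\<^sup>2) = 12 \<Longrightarrow> \<exists>i0. c i0 = 0 \<and> (\<forall>i. i \<noteq> i0 \<longrightarrow> c i = 2)"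
proof -
  obtain i0 i1 i2 i3 :: 'i where i: "UNIV = {i0, i1, i2, i3}" "distinct [i0, i1, i2, i3]"
    using four_elements assms(1) by blast
  have [simp]: "sum f UNIV = f i0 + f i1 + f i2 + f i3" for f :: "'i \<Rightarrow> nat"
    unfolding i(1) using i(2) by simp
  have all: "(\<forall>j. P j) \<longleftrightarrow> P i0 \<and> P i1 \<and> P i2 \<and> P i3" for P
    using i(1) by (metis UNIV_I empty_iff insert_iff)
  have ex: "(\<exists>j. P j) \<longleftrightarrow> P i0 \<or> P i1 \<or> P i2 \<or> P i3" for P
    using all[of "\<lambda>j. \<not> P j"] by blast
  note cs = nat_le_2_cases[OF assms(2)[of i0]] nat_le_2_cases[OF assms(2)[of i1]]
    nat_le_2_cases[OF assms(2)[of i2]] nat_le_2_cases[OF assms(2)[of i3]]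
  show "sum c UNIV = 5 \<Longrightarrow> (\<Sum>i\<in>UNIV. (c i)\<^sup>2) \<le> 9"
    and "sum c UNIV = 6 \<Longrightarrow> (\<Sum>i\<in>UNIV. (c i)\<^sup>2) \<in> {10, 12}"
    and "sum c UNIV = 7 \<Longrightarrow> (\<Sum>i\<in>UNIV. (c i)\<^sup>2) \<le> 13"
    and "sum c UNIV = 8 \<Longrightarrow> (\<Sum>i\<in>UNIV. (c i)\<^sup>2) \<le> 16"
    using cs by (elim disjE; simp)+
  show "sum c UNIV = 6 \<Longrightarrow> (\<Sum>i\<in>UNIV. (c i)\<^sup>2) = 12 \<Longrightarrow> \<exists>i0. c i0 = 0 \<and> (\<forall>i. i \<noteq> i0 \<longrightarrow> c i = 2)"
    unfolding all ex using cs i(2) by (elim disjE; simp)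
qed

text \<open>The extreme patterns are 3300, 3310 and 3320.\<close>

lemma sum_squares_max3:
  fixes c :: "'i::finite \<Rightarrow> nat"
  assumes "CARD('i) = 4" "\<And>i. c i \<le> 3"
  shows "sum c UNIV = 6 \<Longrightarrow> (\<Sum>i\<in>UNIV. (c i)\<^sup>2) \<le> 18"
    and "sum c UNIV = 7 \<Longrightarrow> (\<Sum>i\<in>UNIV. (c i)\<^sup>2) \<le> 19"
    and "sum c UNIV = 8 \<Longrightarrow> (\<Sum>i\<in>UNIV. (c i)\<^sup>2) \<le> 22"
    and "sum c UNIV = 6 \<Longrightarrow> (\<Sum>i\<in>UNIV. (c i)\<^sup>2) = 18 \<Longrightarrow> c i \<in> {0, 3}"
proof -
  obtain i0 i1 i2 i3 :: 'i where i: "UNIV = {i0, i1, i2, i3}" "distinct [i0, i1, i2, i3]"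
    using four_elements assms(1) by blast
  have [simp]: "sum f UNIV = f i0 + f i1 + f i2 + f i3" for f :: "'i \<Rightarrow> nat"
    unfolding i(1) using i(2) by simp
  have i': "i = i0 \<or> i = i1 \<or> i = i2 \<or> i = i3"
    using i(1) by blast
  note cs = nat_le_3_cases[OF assms(2)[of i0]] nat_le_3_cases[OF assms(2)[of i1]]
    nat_le_3_cases[OF assms(2)[of i2]] nat_le_3_cases[OF assms(2)[of i3]]
  show "sum c UNIV = 6 \<Longrightarrow> (\<Sum>i\<in>UNIV. (c i)\<^sup>2) \<le> 18"
    and "sum c UNIV = 7 \<Longrightarrow> (\<Sum>i\<in>UNIV. (c i)\<^sup>2) \<le> 19"
    and "sum c UNIV = 8 \<Longrightarrow> (\<Sum>i\<in>UNIV. (c i)\<^sup>2) \<le> 22"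
    using cs by (elim disjE; simp)+
  have "sum c UNIV = 6 \<Longrightarrow> (\<Sum>i\<in>UNIV. (c i)\<^sup>2) = 18 \<Longrightarrow>
    c i0 \<in> {0, 3} \<and> c i1 \<in> {0, 3} \<and> c i2 \<in> {0, 3} \<and> c i3 \<in> {0, 3}"
    using cs by (elim disjE; simp)
  then show "sum c UNIV = 6 \<Longrightarrow> (\<Sum>i\<in>UNIV. (c i)\<^sup>2) = 18 \<Longrightarrow> c i \<in> {0, 3}"
    using i' by blast
qed

section \<open>Counting arc points on the 16 lines of a class\<close>

text \<open>The 16 lines \<open>j\<close> of one neighbour class of lines meet each of the five point classes \<open>x \<in> A\<close> of
  that class in one of four parallel segments, \<open>s x j\<close>; \<open>c x i\<close> counts the arc points on segment \<open>i\<close>.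
  By \<open>oa\<close> the lines form an orthogonal array, and \<open>S j\<close> below is the number of arc points on \<open>j\<close>.\<close>

locale net =
  fixes A :: "'p set" and c :: "'p \<Rightarrow> 'i::finite \<Rightarrow> nat" and s :: "'p \<Rightarrow> 'j::finite \<Rightarrow> 'i"
  assumes card_A: "card A = 5"
    and card_i: "CARD('i) = 4"
    and oa: "\<lbrakk>x \<in> A; y \<in> A; x \<noteq> y\<rbrakk> \<Longrightarrow> bij (\<lambda>j. (s x j, s y j))"
    and cap: "(\<Sum>x\<in>A. c x (s x j)) \<le> 7"
begin

definition wt :: "'p \<Rightarrow> nat" where "wt x = sum (c x) UNIV"
definition total :: nat where "total = sum wt A"
definition S :: "'j \<Rightarrow> nat" where "S j = (\<Sum>x\<in>A. c x (s x j))"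

lemma finite_A: "finite A"
  using card_A by (metis card.infinite zero_neq_numeral)

lemma S_le: "S j \<le> 7"
  using cap by (simp add: S_def)

text \<open>Fixing one coordinate of the orthogonal array: the lines through a segment of
  \<open>x\<close> run through each segment of \<open>y\<close> once.\<close>

lemma bij_segment:
  assumes "x \<in> A" "y \<in> A" "x \<noteq> y"
  shows "bij_betw (s y) {j. s x j = i} UNIV"
proof -
  have b: "bij (\<lambda>j. (s x j, s y j))"
    using oa assms by blast
  show ?thesis
  proof (rule bij_betwI')
    show "(s y j = s y j') = (j = j')" if "j \<in> {j. s x j = i}" "j' \<in> {j. s x j = i}" for j j'
      using that bij_is_inj[OF b] by (auto dest!: injD[of _ j j'])
    show "\<exists>j\<in>{j. s x j = i}. k = s y j" for k
      using surjD[OF bij_is_surj[OF b], of "(i, k)"] by auto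
  qed auto
qed

lemma meet:
  assumes "x \<in> A" "y \<in> A" "x \<noteq> y"
  obtains j where "s x j = i" "s y j = k"
  using surjD[OF bij_is_surj[OF oa[OF assms]], of "(i, k)"] by auto

lemma meet_unique:
  assumes "x \<in> A" "y \<in> A" "x \<noteq> y" "s x j = s x j'" "s y j = s y j'"
  shows "j = j'"
  using bij_is_inj[OF oa[OF assms(1-3)]] assms(4,5) by (auto dest!: injD[of _ j j'])

lemma sum_segment_other:
  assumes "x \<in> A" "y \<in> A" "x \<noteq> y"
  shows "(\<Sum>j | s x j = i. c y (s y j)) = wt y"
  unfolding wt_def using sum.reindex_bij_betw[OF bij_segment[OF assms], of "c y" i] .

lemma card_segment:
  assumes "x \<in> A"
  shows "card {j. s x j = i} = 4"
proof -
  have "card (A - {x}) = 4"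
    using card_A assms finite_A by simp
  then obtain y where "y \<in> A" "x \<noteq> y"
    by (metis DiffE card.empty equals0I insertI1 zero_neq_numeral)
  from bij_betw_same_card[OF bij_segment[OF assms this]] show ?thesis
    using card_i by simp
qed

text \<open>The four lines through a segment share it and partition every other point class. Adding
  \<open>wt x\<close> on the left avoids truncated subtraction.\<close>

lemma sum_segment:
  assumes "x \<in> A"
  shows "(\<Sum>j | s x j = i. S j) + wt x = 4 * c x i + total"
proof -
  have "(\<Sum>j | s x j = i. S j) = (\<Sum>y\<in>A. \<Sum>j | s x j = i. c y (s y j))"
    unfolding S_def by (rule sum.swap)
  also have "\<dots> = (\<Sum>j | s x j = i. c x (s x j)) + (\<Sum>y\<in>A - {x}. \<Sum>j | s x j = i. c y (s y j))"
    using assms finite_A by (simp add: sum.remove)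
  also have "(\<Sum>j | s x j = i. c x (s x j)) = 4 * c x i"
    using card_segment[OF assms, of i] by simp
  also have "(\<Sum>y\<in>A - {x}. \<Sum>j | s x j = i. c y (s y j)) = sum wt (A - {x})"
    using sum_segment_other assms by (intro sum.cong) auto
  finally show ?thesis
    using assms finite_A by (simp add: total_def sum.remove[of A x])
qed

lemma total_le:
  assumes "x \<in> A"
  shows "4 * c x i + total \<le> 28 + wt x"
proof -
  have "(\<Sum>j | s x j = i. S j) \<le> 28"
    using sum_bounded_above[of "{j. s x j = i}" S 7] S_le card_segment[OF assms] by simp
  then show ?thesis
    using sum_segment[OF assms, of i] by simp
qed

text \<open>The slack in \<open>total_le\<close>, distributed over the four lines.\<close>

lemma deficit_segment:
  assumes "x \<in> A"
  shows "(\<Sum>j | s x j = i. 7 - S j) + 4 * c x i + total = 28 + wt x"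
proof -
  have "(\<Sum>j | s x j = i. 7 - S j) + (\<Sum>j | s x j = i. S j) = (\<Sum>j | s x j = i. 7)"
    unfolding sum.distrib[symmetric] using S_le by (intro sum.cong) auto
  then show ?thesis
    using sum_segment[OF assms, of i] card_segment[OF assms, of i] by simp
qed

text \<open>Equality in \<open>total_le\<close> leaves no deficit for any line through the
  segment.\<close>

lemma saturated:
  assumes "x \<in> A" "4 * c x (s x j) + total = 28 + wt x"
  shows "S j = 7"
proof -
  have "(\<Sum>j' | s x j' = s x j. 7 - S j') = 0"
    using deficit_segment[OF assms(1), of "s x j"] assms(2) by linarith
  then have "7 - S j = 0"
    by (simp add: sum_eq_0_iff)
  with S_le[of j] show ?thesis by simp
qed

section \<open>Excluded weight distributions in one line class\<close>

text \<open>Every line whose deficit \<open>d = 7 - S\<close> is positive has \<open>S \<ge> 3\<close>, so \<open>\<Sum> d S \<ge> 3 \<Sum> d = 36\<close>, whereas counting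
  by segments gives \<open>\<Sum> d S = 20\<close>.\<close>

lemma all_five_impossible:
  assumes wt5: "\<And>x. x \<in> A \<Longrightarrow> wt x = 5"
    and le2: "\<And>x i. x \<in> A \<Longrightarrow> c x i \<le> 2"
    and sq: "\<And>x. x \<in> A \<Longrightarrow> (\<Sum>i\<in>UNIV. (c x i)\<^sup>2) = 9"
  shows False
proof -
  define d where "d j = 7 - S j" for j
  have total: "total = 25"
    using wt5 card_A by (simp add: total_def)
  have seg: "(\<Sum>j | s x j = i. d j) = 8 - 4 * c x i" if "x \<in> A" for x i
    using deficit_segment[OF that, of i] wt5[OF that] total by (simp add: d_def)
  \<comment> \<open>A segment with two points has total deficit 0, so a line with positive deficit
    meets each class in at most one arc point.\<close>
  have S_le5: "S j \<le> 5" if "d j > 0" for j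
  proof -
    have "c x (s x j) \<le> 1" if "x \<in> A" for x
    proof -
      have "d j \<le> (\<Sum>j' | s x j' = s x j. d j')"
        by (rule member_le_sum) auto
      then show ?thesis
        using \<open>d j > 0\<close> seg[OF that, of "s x j"] by simp
    qed
    then have "S j \<le> of_nat (card A) * 1"
      unfolding S_def by (intro sum_bounded_above) auto
    then show ?thesis using card_A by simp
  qed
  have S_pos: "S j > 0" for j
  proof (rule ccontr)
    assume "\<not> S j > 0"
    then have Sj: "S j = 0" by simp
    obtain x where x: "x \<in> A"
      using card_A by fastforce
    have "c x (s x j) = 0"
      using Sj x finite_A by (simp add: S_def)
    then have "(\<Sum>j' | s x j' = s x j. d j') = 8"
      using seg[OF x, of "s x j"] by simp
    \<comment> \<open>Here \<open>d j = 7\<close>, which leaves deficit 1 for another line through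
      the segment; that line has at least 6 points, against \<open>S_le5\<close>.\<close>
    then have 1: "(\<Sum>j' \<in> {j'. s x j' = s x j} - {j}. d j') = 1"
      using Sj by (simp add: sum.remove[of "{j'. s x j' = s x j}" j] d_def)
    then obtain j' where j': "j' \<in> {j'. s x j' = s x j} - {j}" "d j' > 0"
      by (metis neq0_conv sum.neutral zero_neq_one)
    then have "d j' \<le> 1"
      using 1 member_le_sum[of j' "{j'. s x j' = s x j} - {j}" d] by simp
    with S_le5[OF j'(2)] show False
      by (simp add: d_def)
  qed
  have S_ge3: "3 * d j \<le> d j * S j" for j
  proof (cases "d j = 0")
    case False
    have "S j \<noteq> 0"
      using S_pos[of j] by simp
    then obtain x where x: "x \<in> A" "c x (s x j) \<noteq> 0"
      unfolding S_def sum_eq_0_iff[OF finite_A] by blast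
    have "d j \<le> (\<Sum>j' | s x j' = s x j. d j')"
      by (rule member_le_sum) auto
    \<comment> \<open>A nonempty segment has total deficit at most 4.\<close>
    then have "d j \<le> 4"
      using seg[OF x(1), of "s x j"] x(2) by simp
    then have "3 \<le> S j"
      using S_le[of j] unfolding d_def by linarith
    then show ?thesis
      using mult_le_mono2[of 3 "S j" "d j"] by (simp only: mult.commute[of 3])
  qed simp
  have by_seg: "(\<Sum>j\<in>UNIV. g (s x j) * d j) = (\<Sum>i\<in>UNIV. g i * (8 - 4 * c x i))"
    if "x \<in> A" for x and g :: "'i \<Rightarrow> nat"
  proof -
    have "(\<Sum>j\<in>UNIV. g (s x j) * d j) = (\<Sum>i\<in>UNIV. \<Sum>j | s x j = i. g (s x j) * d j)"
      by (rule sum_fibres[symmetric])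
    also have "\<dots> = (\<Sum>i\<in>UNIV. g i * (\<Sum>j | s x j = i. d j))"
      unfolding sum_distrib_left by (auto intro!: sum.cong)
    finally show ?thesis
      using seg[OF that] by simp
  qed
  have dS: "(\<Sum>j\<in>UNIV. d j * S j) = 20"
  proof -
    have "(\<Sum>j\<in>UNIV. d j * S j) = (\<Sum>x\<in>A. \<Sum>j\<in>UNIV. c x (s x j) * d j)"
      unfolding S_def sum_distrib_left by (subst sum.swap) (simp add: mult.commute)
    also have "\<dots> = (\<Sum>x\<in>A. 4)"
    proof (rule sum.cong)
      fix x assume x: "x \<in> A"
      \<comment> \<open>Entries are at most 2, so the subtraction is exact; each class contributes
        40 - 36 = 4.\<close>
      have "(\<Sum>i\<in>UNIV. c x i * (8 - 4 * c x i)) + 4 * (\<Sum>i\<in>UNIV. (c x i)\<^sup>2)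
          = (\<Sum>i\<in>UNIV. 8 * c x i)"
        unfolding sum_distrib_left sum.distrib[symmetric]
      proof (rule sum.cong)
        show "c x i * (8 - 4 * c x i) + 4 * (c x i)\<^sup>2 = 8 * c x i" for i
          using nat_le_2_cases[OF le2[OF x, of i]] by auto
      qed simp
      also have "\<dots> = 40"
        using wt5[OF x] by (simp add: wt_def sum_distrib_left[symmetric])
      finally show "(\<Sum>j\<in>UNIV. c x (s x j) * d j) = 4"
        using sq[OF x] by_seg[OF x, of "c x"] by simp
    qed simp
    finally show ?thesis using card_A by simp
  qed
  have "(\<Sum>j\<in>UNIV. d j) = 12"
  proof -
    obtain x where x: "x \<in> A"
      using card_A by fastforce
    have "(\<Sum>i\<in>UNIV. (8 - 4 * c x i)) + 4 * wt x = (\<Sum>i\<in>(UNIV::'i set). 8)"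
      unfolding sum_distrib_left sum.distrib[symmetric] wt_def using le2[OF x]
      by (intro sum.cong) auto
    then show ?thesis
      using by_seg[OF x, of "\<lambda>_. 1"] card_i wt5[OF x] by simp
  qed
  then have "36 \<le> (\<Sum>j\<in>UNIV. d j * S j)"
    using sum_mono[of UNIV "\<lambda>j. 3 * d j" "\<lambda>j. d j * S j"] S_ge3
    by (simp add: sum_distrib_left[symmetric])
  with dS show False by simp
qed

text \<open>Of the four lines through the empty segment of \<open>x\<close>, at least three meet
  \<open>y\<close> in two points and are full. They carry 21 points, but the four lines together
  carry only 26 - 6 = 20.\<close>

lemma two_2220_impossible:
  assumes "total = 26" "x \<in> A" "y \<in> A" "x \<noteq> y" "wt x = 6" "wt y = 6"
    and x: "c x i = 0" and y: "\<And>k. k \<noteq> k0 \<Longrightarrow> c y k = 2"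
  shows False
proof -
  obtain j where j: "s x j = i" "s y j = k0"
    using meet assms(2-4) by metis
  have "S j' = 7" if "j' \<in> {j'. s x j' = i} - {j}" for j'
  proof -
    have "s y j' \<noteq> k0"
      using that j meet_unique[OF assms(2-4), of j j'] by auto
    then show ?thesis
      using saturated[OF assms(3)] y assms by simp
  qed
  then have 21: "(\<Sum>j' \<in> {j'. s x j' = i} - {j}. S j') = 21"
    using card_segment[OF assms(2), of i] j by simp
  have "(\<Sum>j' \<in> {j'. s x j' = i} - {j}. S j') \<le> (\<Sum>j' | s x j' = i. S j')"
    by (intro sum_mono2) auto
  with 21 show False
    using sum_segment[OF assms(2), of i] x assms by simp
qed

text \<open>The line through the empty segment of \<open>x\<close> and a 2-segment of
  \<open>y\<close> would be full, yet it has at most 0 + 2 + 2 + 1 + 1 points.\<close>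

lemma six_six_six_four_four_2220_impossible:
  assumes "total = 26" "A = {x, y, z, p, q}" "distinct [x, y, z, p, q]" "wt y = 6"
    and x: "c x i = 0" and y: "c y k = 2" and z: "\<And>i. c z i \<le> 2"
    and pq: "\<And>i. c p i \<le> 1" "\<And>i. c q i \<le> 1"
  shows False
proof -
  obtain j where j: "s x j = i" "s y j = k"
    using meet[of x y i k] assms(2,3) by auto
  have "S j = 7"
    using saturated[of y j] assms(1-4) y j by simp
  moreover have "S j = c x (s x j) + c y (s y j) + c z (s z j) + c p (s p j) + c q (s q j)"
    using assms(3) by (subst S_def) (simp add: assms(2) add.assoc)
  ultimately show False
    using x y z[of "s z j"] pq(1)[of "s p j"] pq(2)[of "s q j"] j by simp
qed

text \<open>A line carrying 3 points on one of the segments of \<open>x, y, z\<close> is full. On a segment of \<open>p\<close> without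
  arc points this forces \<open>c x + c y + c z \<le> 6 c q\<close>, and summing over the segment gives \<open>18 \<le> 12\<close>.\<close>

lemma three_3300_impossible:
  assumes "total = 22" "A = {x, y, z, p, q}" "distinct [x, y, z, p, q]"
    and six: "\<And>v. v \<in> {x, y, z} \<Longrightarrow> wt v = 6" and two: "wt p = 2" "wt q = 2"
    and c: "\<And>v i. v \<in> {x, y, z} \<Longrightarrow> c v i \<in> {0, 3}"
  shows False
proof -
  obtain i where i: "c p i = 0"
  proof -
    have "\<not> (\<forall>i. c p i \<ge> 1)"
      using sum_mono[of UNIV "\<lambda>_. 1" "c p"] card_i two(1) by (force simp: wt_def)
    then show thesis
      using that by (meson less_one not_le)
  qed
  \<comment> \<open>If m > 0 of the three segments carry 3 points, the line is full and 3m + c q =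
    7. So m = 1 with c q = 4, or m = 2 with c q = 1.\<close>
  have "c x (s x j) + c y (s y j) + c z (s z j) \<le> 6 * c q (s q j)" if "s p j = i" for j
  proof -
    have Sj: "S j = c x (s x j) + c y (s y j) + c z (s z j) + c p (s p j) + c q (s q j)"
      using assms(3) by (subst S_def) (simp add: assms(2) add.assoc)
    have sat: "S j = 7" if "v \<in> {x, y, z}" "c v (s v j) = 3" for v
      using saturated[of v j] that assms(1,2) six[OF that(1)] by auto
    show ?thesis
      using c[of x "s x j"] c[of y "s y j"] c[of z "s z j"] sat[of x] sat[of y] sat[of z] Sj i that
      by auto
  qed
  then have "(\<Sum>j | s p j = i. c x (s x j) + c y (s y j) + c z (s z j))
      \<le> (\<Sum>j | s p j = i. 6 * c q (s q j))"
    by (intro sum_mono) auto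
  moreover have "p \<noteq> x" "p \<noteq> y" "p \<noteq> z" "p \<noteq> q"
    using assms(3) by auto
  ultimately have "wt x + wt y + wt z \<le> 6 * wt q"
    using sum_segment_other[of p x i] sum_segment_other[of p y i] sum_segment_other[of p z i]
      sum_segment_other[of p q i] assms(2)
    by (simp add: sum.distrib sum_distrib_left[symmetric])
  with six two show False by simp
qed

end

section \<open>Point classes and line classes\<close>

text \<open>Turns termwise estimates whose total is attained into equalities; most structural facts
  below arise this way.\<close>

lemma sum_bound_tight:
  fixes f g :: "'a \<Rightarrow> nat"
  assumes "finite A" "\<And>x. x \<in> A \<Longrightarrow> f x \<le> g x" "sum g A \<le> sum f A" "x \<in> A"
  shows "f x = g x"
proof (rule ccontr)
  assume "f x \<noteq> g x"
  then have "f x < g x"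
    using assms(2,4) by (simp add: le_neq_implies_less)
  then have "sum f A < sum g A"
    using assms by (intro sum_strict_mono_ex1) auto
  with assms(3) show False by simp
qed

lemma sum_card_swap:
  assumes "finite A" "finite B"
  shows "(\<Sum>x\<in>A. card {y \<in> B. R x y}) = (\<Sum>y\<in>B. card {x \<in> A. R x y})"
proof -
  have "(\<Sum>x\<in>A. card {y \<in> B. R x y}) = (\<Sum>x\<in>A. \<Sum>y\<in>B. if R x y then 1 else 0)"
    using assms by (simp add: sum.If_cases Int_def)
  also have "\<dots> = (\<Sum>y\<in>B. \<Sum>x\<in>A. if R x y then 1 else 0)"
    by (rule sum.swap)
  also have "\<dots> = (\<Sum>y\<in>B. card {x \<in> A. R x y})"
    using assms by (simp add: sum.If_cases Int_def)
  finally show ?thesis .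
qed

text \<open>Here \<open>c p l i\<close> is the number of arc points on the \<open>i\<close>-th segment of the point class \<open>p\<close> in the
  direction \<open>l\<close>, and \<open>u p\<close> the number of arc points in \<open>p\<close>. The assumption \<open>squares\<close> says that two
  points of a class lie on a common segment in exactly one of the five directions.\<close>

locale arc_weights =
  fixes inc :: "'p::finite \<Rightarrow> 'l::finite \<Rightarrow> bool"
    and c :: "'p \<Rightarrow> 'l \<Rightarrow> 'i::finite \<Rightarrow> nat"
    and s :: "'l \<Rightarrow> 'p \<Rightarrow> 'j::finite \<Rightarrow> 'i"
    and u :: "'p \<Rightarrow> nat"
  assumes card_points: "CARD('p) = 21" and card_lines: "CARD('l) = 21"
    and lines_on: "card {l. inc p l} = 5"
    and join: "p \<noteq> q \<Longrightarrow> \<exists>!l. inc p l \<and> inc q l"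
    and net: "net {p. inc p l} (\<lambda>p. c p l) (s l)"
    and weight: "inc p l \<Longrightarrow> sum (c p l) UNIV = u p"
    and squares: "(\<Sum>l | inc p l. \<Sum>i\<in>UNIV. (c p l i)\<^sup>2) = (u p)\<^sup>2 + 4 * u p"
    and total_weight: "(\<Sum>p\<in>UNIV. u p) = 102"
begin

section \<open>Weight totals over the plane\<close>

definition T :: "'l \<Rightarrow> nat" where "T l = (\<Sum>p | inc p l. u p)"
definition sq :: "'p \<Rightarrow> 'l \<Rightarrow> nat" where "sq p l = (\<Sum>i\<in>UNIV. (c p l i)\<^sup>2)"
definition mx :: "'p \<Rightarrow> 'l \<Rightarrow> nat" where "mx p l = Max (range (c p l))"

lemma points_on: "card {p. inc p l} = 5"
  using net.card_A[OF net] .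

lemma card_i: "CARD('i) = 4"
  using net.card_i[OF net] .

lemma net_wt: "inc p l \<Longrightarrow> net.wt (\<lambda>p. c p l) p = u p"
  by (simp add: net.wt_def[OF net] weight)

lemma net_total: "net.total {p. inc p l} (\<lambda>p. c p l) = T l"
  unfolding net.total_def[OF net] T_def by (intro sum.cong) (auto simp: net_wt)

lemma T_le: "inc p l \<Longrightarrow> 4 * c p l i + T l \<le> 28 + u p"
  using net.total_le[OF net, of p l i] by (simp add: net_wt net_total)

text \<open>A class other than \<open>p\<close> is on one of the five lines, while \<open>p\<close>
  is on all of them and gains four extra copies.\<close>

lemma sum_lines_on: "(\<Sum>l | inc p l. \<Sum>q | inc q l. f q) = (\<Sum>q\<in>UNIV. f q) + 4 * (f p :: nat)"
proof -
  have "(\<Sum>l | inc p l. \<Sum>q | inc q l. f q) = (\<Sum>l | inc p l. \<Sum>q\<in>UNIV. if inc q l then f q else 0)"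
    by (simp add: sum.If_cases)
  also have "\<dots> = (\<Sum>q\<in>UNIV. \<Sum>l | inc p l. if inc q l then f q else 0)"
    by (rule sum.swap)
  also have "\<dots> = (\<Sum>q\<in>UNIV. card {l. inc p l \<and> inc q l} * f q)"
    by (simp add: sum.If_cases Collect_conj_eq)
  also have "\<dots> = (\<Sum>q\<in>UNIV. f q + (if q = p then 4 * f q else 0))"
  proof (rule sum.cong)
    fix q
    have "card {l. inc p l \<and> inc q l} = 1" if ne: "q \<noteq> p"
    proof -
      obtain l where "inc p l \<and> inc q l" "\<And>k. inc p k \<and> inc q k \<Longrightarrow> k = l"
        using join[of p q] ne by metis
      then have "{l. inc p l \<and> inc q l} = {l}" by blast
      then show ?thesis by simp
    qed
    then show "card {l. inc p l \<and> inc q l} * f q = f q + (if q = p then 4 * f q else 0)"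
      using lines_on[of p] by auto
  qed simp
  also have "\<dots> = (\<Sum>q\<in>UNIV. f q) + 4 * f p"
    by (simp add: sum.distrib)
  finally show ?thesis .
qed

lemma sum_T_on: "(\<Sum>l | inc p l. T l) = 102 + 4 * u p"
  using sum_lines_on[of u p] total_weight by (simp add: T_def)

lemma sum_T: "(\<Sum>l\<in>UNIV. T l) = 510"
proof -
  have "(\<Sum>l\<in>UNIV. T l) = (\<Sum>l\<in>UNIV. \<Sum>q\<in>UNIV. if inc q l then u q else 0)"
    by (simp add: T_def sum.If_cases)
  also have "\<dots> = (\<Sum>q\<in>UNIV. \<Sum>l\<in>UNIV. if inc q l then u q else 0)"
    by (rule sum.swap)
  also have "\<dots> = (\<Sum>q\<in>UNIV. 5 * u q)"
    by (simp add: sum.If_cases lines_on)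
  finally show ?thesis
    using total_weight by (simp add: sum_distrib_left[symmetric])
qed

section \<open>Largest segments and the bound of six points per class\<close>

lemma c_le_mx: "c p l i \<le> mx p l"
  by (simp add: mx_def)

lemma mx_attained: "\<exists>i. c p l i = mx p l"
proof -
  have "mx p l \<in> range (c p l)"
    unfolding mx_def by (rule Max_in) auto
  then show ?thesis by auto
qed

lemma T_le_mx: "inc p l \<Longrightarrow> 4 * mx p l + T l \<le> 28 + u p"
  using T_le mx_attained by metis

lemma u_le_mx: "inc p l \<Longrightarrow> u p \<le> 4 * mx p l"
  using sum_le_four_times[OF card_i, of "c p l" "mx p l"] c_le_mx weight by simp

text \<open>Adding \<open>T_le_mx\<close> over five directions: four times the maxima plus 102 + 4 u
  is at most 5 (28 + u).\<close>

lemma sum_mx_le: "4 * (\<Sum>l | inc p l. mx p l) \<le> 38 + u p"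
proof -
  have "(\<Sum>l | inc p l. 4 * mx p l + T l) \<le> (\<Sum>l | inc p l. 28 + u p)"
    by (intro sum_mono) (auto simp: T_le_mx)
  then show ?thesis
    by (simp add: sum.distrib sum_T_on lines_on sum_distrib_left[symmetric])
qed

lemma sum_sq: "(\<Sum>l | inc p l. sq p l) = (u p)\<^sup>2 + 4 * u p"
  using squares by (simp add: sq_def)

lemma mx_ge_2: "inc p l \<Longrightarrow> u p \<ge> 5 \<Longrightarrow> 2 \<le> mx p l"
  using u_le_mx by fastforce

lemma mx_le_3:
  assumes "inc p l" "u p \<ge> 5" "u p \<le> 8"
  shows "mx p l \<le> 3"
proof -
  have "(\<Sum>l\<in>{l. inc p l} - {l}. 2) \<le> (\<Sum>l\<in>{l. inc p l} - {l}. mx p l)"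
    using mx_ge_2 assms by (intro sum_mono) auto
  then have "8 \<le> (\<Sum>l\<in>{l. inc p l} - {l}. mx p l)"
    using assms(1) lines_on[of p] by simp
  moreover have "(\<Sum>l | inc p l. mx p l) = mx p l + (\<Sum>l\<in>{l. inc p l} - {l}. mx p l)"
    using assms(1) by (simp add: sum.remove)
  ultimately show ?thesis
    using sum_mx_le[of p] assms(3) by simp
qed

text \<open>The square sum bounds for maximum 2 and maximum 3 differ by 6 in every case. This linear
  form covers both and can be summed against \<open>sum_mx_le\<close>.\<close>

lemma sq_le_of_mx:
  assumes "u p \<le> 8" "u p \<ge> 6" "inc p l"
  shows "sq p l + 12 \<le> (if u p = 6 then 12 else if u p = 7 then 13 else 16) + 6 * mx p l"
proof -
  have u: "u p = 6 \<or> u p = 7 \<or> u p = 8"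
    using assms by linarith
  have mx: "mx p l = 2 \<or> mx p l = 3"
    using mx_ge_2[of p l] mx_le_3[of p l] assms by linarith
  show ?thesis
  proof (cases "mx p l = 2")
    case True
    then have "c p l i \<le> 2" for i
      using c_le_mx[of p l i] by simp
    from sum_squares_max2(2-4)[OF card_i, of "c p l", OF this] show ?thesis
      using u True unfolding weight[OF assms(3)] sq_def by auto
  next
    case False
    with mx have mx3: "mx p l = 3" by simp
    then have "c p l i \<le> 3" for i
      using c_le_mx[of p l i] by simp
    from sum_squares_max3(1-3)[OF card_i, of "c p l", OF this] show ?thesis
      using u mx3 unfolding weight[OF assms(3)] sq_def by auto
  qed
qed

lemma u_le_6: "u p \<le> 6"
proof (rule ccontr)
  assume "\<not> u p \<le> 6"
  then consider "u p \<ge> 9" | "u p = 7" | "u p = 8" by linarith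
  then show False
  proof cases
    case 1
    \<comment> \<open>The maxima sum to at least 15, so \<open>u p \<ge> 22\<close>; the second
      estimate gives \<open>5 * u p \<le> 38 + u p\<close>.\<close>
    have "3 \<le> mx p l" if "inc p l" for l
      using u_le_mx[OF that] 1 by linarith
    then have "(\<Sum>l | inc p l. 3) \<le> (\<Sum>l | inc p l. mx p l)"
      by (intro sum_mono) auto
    moreover have "(\<Sum>l | inc p l. u p) \<le> (\<Sum>l | inc p l. 4 * mx p l)"
      by (intro sum_mono) (auto simp: u_le_mx)
    ultimately show False
      using sum_mx_le[of p] by (simp add: lines_on sum_distrib_left[symmetric])
  next
    case 2
    \<comment> \<open>The square sum 77 forces the maxima to sum to at least 12, but at most 11 is
      allowed. For 8 points the square sum 96 forces 13.\<close>
    have "(\<Sum>l | inc p l. sq p l + 12) \<le> (\<Sum>l | inc p l. 13 + 6 * mx p l)"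
      using sq_le_of_mx[of p] 2 by (intro sum_mono) auto
    then show False
      using sum_mx_le[of p] 2 sum_sq[of p]
      by (simp add: sum.distrib lines_on sum_distrib_left[symmetric])
  next
    case 3
    have "(\<Sum>l | inc p l. sq p l + 12) \<le> (\<Sum>l | inc p l. 16 + 6 * mx p l)"
      using sq_le_of_mx[of p] 3 by (intro sum_mono) auto
    then show False
      using sum_mx_le[of p] 3 sum_sq[of p]
      by (simp add: sum.distrib lines_on sum_distrib_left[symmetric])
  qed
qed

text \<open>The maxima are at least 2 and sum to at most 10, so all equal 2. Each square sum is then
  at most 9, and the total 45 leaves no slack.\<close>

lemma five_directions:
  assumes "u p = 5" "inc p l"
  shows "c p l i \<le> 2" "sq p l = 9"
proof -
  have mx2: "2 = mx p k" if "inc p k" for k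
    using sum_mx_le[of p] assms that lines_on[of p]
    by (intro sum_bound_tight[of "{l. inc p l}" "\<lambda>_. 2" "mx p"]) (auto simp: mx_ge_2)
  then have le2: "c p k i \<le> 2" if "inc p k" for k i
    using that c_le_mx by metis
  then show "c p l i \<le> 2"
    using assms by blast
  have "sq p k \<le> 9" if "inc p k" for k
    using sum_squares_max2(1)[OF card_i, of "c p k"] le2[OF that] weight[OF that] assms
    by (simp add: sq_def)
  then show "sq p l = 9"
    using sum_sq[of p] assms lines_on[of p]
    by (intro sum_bound_tight[of "{l. inc p l}" "sq p" "\<lambda>_. 9"]) auto
qed

lemma sq_six_max2:
  assumes "u p = 6" "inc p l" "\<And>i. c p l i \<le> 2"
  shows "sq p l = 10 \<or> sq p l = 12"
  using sum_squares_max2(2)[OF card_i, of "c p l", OF assms(3)] weight[OF assms(2)] assms(1) by (simp add: sq_def)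

text \<open>A class of six points is a hyperoval of the affine plane (every direction of type 2220)
  unless it is special; a special class makes all the estimates for the lines through it tight.\<close>

definition special :: "'p \<Rightarrow> bool" where
  "special p \<longleftrightarrow> u p = 6 \<and> (\<exists>l. inc p l \<and> sq p l \<noteq> 12)"

text \<open>If all maxima were 2, the total 60 would force square sum 12 in each direction. So one
  maximum is 3; as they sum to at most 11, the others are 2, and then every \<open>T_le_mx\<close>
  is an equality.\<close>

lemma special_tight:
  assumes "special p"
  shows "\<exists>l0. inc p l0 \<and> T l0 = 22 \<and> (\<forall>i. c p l0 i \<le> 3) \<and>
    (\<forall>l. inc p l \<longrightarrow> l \<noteq> l0 \<longrightarrow> T l = 26 \<and> (\<forall>i. c p l i \<le> 2))"
proof -
  have u: "u p = 6"
    using assms by (simp add: special_def)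
  have "\<exists>l0. inc p l0 \<and> mx p l0 \<noteq> 2"
  proof (rule ccontr)
    assume "\<not> ?thesis"
    then have le2: "c p l i \<le> 2" if "inc p l" for l i
      using c_le_mx that by metis
    have "sq p l \<le> 12" if "inc p l" for l
      using sq_six_max2[OF u that le2[OF that]] by auto
    then have "sq p l = 12" if "inc p l" for l
      using sum_sq[of p] u lines_on[of p] that
      by (intro sum_bound_tight[of "{l. inc p l}" "sq p" "\<lambda>_. 12"]) auto
    then show False
      using assms by (auto simp: special_def)
  qed
  then obtain l0 where l0: "inc p l0" "mx p l0 \<noteq> 2" by blast
  have mx3: "mx p l0 = 3"
    using mx_ge_2[of p l0] mx_le_3[of p l0] l0 u by linarith
  have sum_mx: "(\<Sum>l | inc p l. mx p l) = 3 + (\<Sum>l\<in>{l. inc p l} - {l0}. mx p l)"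
    using l0(1) mx3 by (simp add: sum.remove)
  have card4: "card ({l. inc p l} - {l0}) = 4"
    using l0(1) lines_on[of p] by simp
  have mx2: "2 = mx p l" if "inc p l" "l \<noteq> l0" for l
    using sum_mx sum_mx_le[of p] card4 that u
    by (intro sum_bound_tight[of "{l. inc p l} - {l0}" "\<lambda>_. 2" "mx p"]) (auto simp: mx_ge_2)
  have "(\<Sum>l\<in>{l. inc p l} - {l0}. mx p l) = (\<Sum>l\<in>{l. inc p l} - {l0}. 2)"
    using mx2 by (intro sum.cong) auto
  then have "(\<Sum>l | inc p l. mx p l) = 11"
    using sum_mx card4 by simp
  then have T: "4 * mx p l + T l = 34" if "inc p l" for l
    using that T_le_mx[of p] u lines_on[of p]
    by (intro sum_bound_tight[of "{l. inc p l}" "\<lambda>l. 4 * mx p l + T l" "\<lambda>_. 34"])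
      (auto simp: sum.distrib sum_distrib_left[symmetric] sum_T_on)
  have "T l0 = 22"
    using T[OF l0(1)] mx3 by simp
  moreover have "c p l0 i \<le> 3" for i
    using c_le_mx[of p l0 i] mx3 by simp
  moreover have "T l = 26" if "inc p l" "l \<noteq> l0" for l
    using T[OF that(1)] mx2[OF that] by simp
  moreover have "c p l i \<le> 2" if "inc p l" "l \<noteq> l0" for l i
    using c_le_mx[of p l i] mx2[OF that] by simp
  ultimately show ?thesis
    using l0(1) by blast
qed

text \<open>Otherwise the square sums total at most 18 + 4 * 10 = 58 instead of 60.\<close>

lemma special_has_2220:
  assumes "special p"
  shows "\<exists>l. inc p l \<and> T l = 26 \<and> sq p l = 12"
proof (rule ccontr)
  assume none: "\<not> ?thesis"
  obtain l0 where l0: "inc p l0" "\<And>i. c p l0 i \<le> 3" "\<And>l. inc p l \<Longrightarrow> l \<noteq> l0 \<Longrightarrow> T l = 26"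
    "\<And>l i. inc p l \<Longrightarrow> l \<noteq> l0 \<Longrightarrow> c p l i \<le> 2"
    using special_tight[OF assms] by blast
  have u: "u p = 6"
    using assms by (simp add: special_def)
  have "sq p l = 10" if "inc p l" "l \<noteq> l0" for l
    using sq_six_max2[OF u that(1) l0(4)[OF that]] l0(3)[OF that] none that by blast
  then have "(\<Sum>l\<in>{l. inc p l} - {l0}. sq p l) = (\<Sum>l\<in>{l. inc p l} - {l0}. 10)"
    by (intro sum.cong) auto
  moreover have "(\<Sum>l | inc p l. sq p l) = sq p l0 + (\<Sum>l\<in>{l. inc p l} - {l0}. sq p l)"
    using l0(1) by (simp add: sum.remove)
  moreover have "sq p l0 \<le> 18"
    using sum_squares_max3(1)[OF card_i, of "c p l0", OF l0(2)] weight[OF l0(1)] u by (simp add: sq_def)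
  ultimately show False
    using l0(1) lines_on[of p] sum_sq[of p] u by simp
qed

section \<open>Line classes with 26 arc points\<close>

lemma T26_no_five:
  assumes "T l = 26" "inc p l"
  shows "u p \<noteq> 5"
proof
  assume "u p = 5"
  with mx_ge_2[OF assms(2)] T_le_mx[OF assms(2)] assms(1) show False by simp
qed

lemma T26_le2:
  assumes "T l = 26" "inc p l" "u p = 6"
  shows "c p l i \<le> 2"
  using T_le[OF assms(2), of i] assms by simp

lemma T26_2220:
  assumes "T l = 26" "inc p l" "u p = 6" "sq p l = 12"
  obtains i0 where "c p l i0 = 0" "\<And>i. i \<noteq> i0 \<Longrightarrow> c p l i = 2"
  using sum_squares_max2(5)[OF card_i, of "c p l", OF T26_le2[OF assms(1-3)]] weight[OF assms(2)] assms(3,4)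
  unfolding sq_def by metis

text \<open>With m classes of six and the others of at most four, 6m \<le> 26 \<le> 6m + 4(5 - m)
  gives m = 3 or m = 4; the remaining weight is 8 or 2.\<close>

lemma T26_cases:
  assumes "T l = 26"
  obtains "card {p. inc p l \<and> u p = 6} = 3" "\<And>p. inc p l \<Longrightarrow> u p \<noteq> 6 \<Longrightarrow> u p = 4"
  | "card {p. inc p l \<and> u p = 6} = 4" "\<And>p. inc p l \<Longrightarrow> u p \<noteq> 6 \<Longrightarrow> u p = 2"
proof -
  define X where "X = {p. inc p l \<and> u p = 6}"
  define Y where "Y = {p. inc p l \<and> u p \<noteq> 6}"
  have XY: "{p. inc p l} = X \<union> Y" "X \<inter> Y = {}"
    by (auto simp: X_def Y_def)
  then have card: "card X + card Y = 5"
    using points_on[of l] card_Un_disjoint[of X Y] by simp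
  have "T l = sum u X + sum u Y"
    unfolding T_def XY(1) using XY(2) by (simp add: sum.union_disjoint)
  moreover have "sum u X = 6 * card X"
    by (simp add: X_def)
  ultimately have sum: "6 * card X + sum u Y = 26"
    using assms by simp
  have le4: "u p \<le> 4" if "p \<in> Y" for p
    using that T26_no_five[OF assms, of p] u_le_6[of p] by (auto simp: Y_def)
  then have "sum u Y \<le> card Y * 4"
    using sum_bounded_above[of Y u 4] by simp
  then have "card X = 3 \<or> card X = 4"
    using sum card by linarith
  then show thesis
  proof
    assume 3: "card X = 3"
    have "u p = 4" if "p \<in> Y" for p
      using 3 sum card le4 that by (intro sum_bound_tight[of Y u "\<lambda>_. 4"]) auto
    then have "\<And>p. inc p l \<Longrightarrow> u p \<noteq> 6 \<Longrightarrow> u p = 4"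
      unfolding Y_def by blast
    with 3 show thesis
      unfolding X_def by (rule that(1))
  next
    assume 4: "card X = 4"
    then have "card Y = 1"
      using card by simp
    then obtain y where "Y = {y}"
      using card_1_singletonE by blast
    then have "u p = 2" if "p \<in> Y" for p
      using sum 4 that by simp
    then have "\<And>p. inc p l \<Longrightarrow> u p \<noteq> 6 \<Longrightarrow> u p = 2"
      unfolding Y_def by blast
    with 4 show thesis
      unfolding X_def by (rule that(2))
  qed
qed

lemma T26_unique_2220:
  assumes "T l = 26" "inc p l" "u p = 6" "sq p l = 12" "inc q l" "u q = 6" "sq q l = 12"
  shows "p = q"
proof (rule ccontr)
  assume "p \<noteq> q"
  obtain i where i: "c p l i = 0"
    using T26_2220[OF assms(1-4)] by metis
  obtain k where k: "\<And>j. j \<noteq> k \<Longrightarrow> c q l j = 2"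
    using T26_2220[OF assms(1,5-7)] by metis
  show False
    using net.two_2220_impossible[OF net, of l p q i k] i k \<open>p \<noteq> q\<close> assms
    by (simp add: net_total net_wt)
qed

text \<open>A class of type 2220 excludes the distribution 6, 6, 6, 4, 4 and leaves 6, 6, 6, 6,
  2.\<close>

lemma T26_2220_line:
  assumes "T l = 26" "inc p l" "u p = 6" "sq p l = 12"
  shows "card {q. inc q l \<and> u q = 6} = 4" "inc q l \<Longrightarrow> u q \<noteq> 6 \<Longrightarrow> u q = 2"
proof -
  have "False" if X: "card {q. inc q l \<and> u q = 6} = 3" and Y: "\<And>q. inc q l \<Longrightarrow> u q \<noteq> 6 \<Longrightarrow> u q = 4"
  proof -
    have "card ({q. inc q l \<and> u q = 6} - {p}) = 2"
      using X assms by simp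
    then obtain y z where yz: "{q. inc q l \<and> u q = 6} - {p} = {y, z}" "y \<noteq> z"
      by (auto simp: card_2_iff)
    have "{q. inc q l} = {q. inc q l \<and> u q = 6} \<union> {q. inc q l \<and> u q \<noteq> 6}"
      by auto
    then have "card {q. inc q l \<and> u q \<noteq> 6} = 2"
      using points_on[of l] X card_Un_disjoint[of "{q. inc q l \<and> u q = 6}" "{q. inc q l \<and> u q \<noteq> 6}"]
      by auto
    then obtain a b where ab: "{q. inc q l \<and> u q \<noteq> 6} = {a, b}" "a \<noteq> b"
      by (auto simp: card_2_iff)
    have A: "{q. inc q l} = {p, y, z, a, b}"
      using yz(1) ab(1) assms(2,3) by blast
    have d: "distinct [p, y, z, a, b]"
      using yz ab assms(2,3) by auto
    have y: "inc y l" "u y = 6" and z: "inc z l" "u z = 6"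
      using yz by auto
    have ab': "inc a l" "u a = 4" "inc b l" "u b = 4"
      using ab Y by auto
    obtain i where i: "c p l i = 0"
      using T26_2220[OF assms] by metis
    obtain k where "c y l k = mx y l"
      using mx_attained by blast
    then have k: "c y l k = 2"
      using mx_ge_2[OF y(1)] T26_le2[OF assms(1) y, of k] y by simp
    have le1: "c a l i \<le> 1" "c b l i \<le> 1" for i
      using T_le[OF ab'(1), of i] T_le[OF ab'(3), of i] ab' assms(1) by simp_all
    have "net.total {q. inc q l} (\<lambda>p. c p l) = 26" "net.wt (\<lambda>p. c p l) y = 6"
      using net_total[of l] net_wt[OF y(1)] y(2) assms(1) by simp_all
    from net.six_six_six_four_four_2220_impossible[OF net this(1) A d this(2), of i k]
    show False
      using i k le1 T26_le2[OF assms(1) z] by blast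
  qed
  with T26_cases[OF assms(1)]
  have "card {q. inc q l \<and> u q = 6} = 4 \<and> (\<forall>q. inc q l \<longrightarrow> u q \<noteq> 6 \<longrightarrow> u q = 2)"
    by blast
  then show "card {q. inc q l \<and> u q = 6} = 4" "inc q l \<Longrightarrow> u q \<noteq> 6 \<Longrightarrow> u q = 2"
    by auto
qed

section \<open>Heavy line classes\<close>

definition heavy_lines :: "'l set" where
  "heavy_lines = {l. T l = 26 \<and> (\<exists>p. special p \<and> inc p l \<and> sq p l = 12)}"

text \<open>The line class already contains its only class of type 2220, so any other class of six
  has square sum different from 12 there.\<close>

lemma heavy_special:
  assumes "l \<in> heavy_lines" "inc q l" "u q = 6"
  shows "special q"
proof -
  obtain p where p: "special p" "inc p l" "sq p l = 12" and T: "T l = 26"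
    using assms(1) by (auto simp: heavy_lines_def)
  show ?thesis
  proof (cases "q = p")
    case False
    then have "sq q l \<noteq> 12"
      using T26_unique_2220[OF T, of p q] p assms by (auto simp: special_def)
    then show ?thesis
      using assms by (auto simp: special_def)
  qed (use p in simp)
qed

lemma heavy_card_special:
  assumes "l \<in> heavy_lines"
  shows "card {q. special q \<and> inc q l} = 4"
proof -
  have "{q. special q \<and> inc q l} = {q. inc q l \<and> u q = 6}"
    using heavy_special[OF assms] by (auto simp: special_def)
  then show ?thesis
    using assms T26_2220_line(1) by (auto simp: heavy_lines_def special_def)
qed

lemma heavy_two: "l \<in> heavy_lines \<Longrightarrow> inc q l \<Longrightarrow> \<not> special q \<Longrightarrow> u q = 2"
  using T26_2220_line(2) heavy_special unfolding heavy_lines_def special_def by blast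

lemma heavy_unique: "l \<in> heavy_lines \<Longrightarrow> card {q. special q \<and> inc q l \<and> sq q l = 12} = 1"
proof -
  assume "l \<in> heavy_lines"
  then obtain p where p: "special p" "inc p l" "sq p l = 12" and T: "T l = 26"
    by (auto simp: heavy_lines_def)
  have "q = p" if "special q" "inc q l" "sq q l = 12" for q
    using T26_unique_2220[OF T that(2) _ that(3) p(2) _ p(3)] that(1) p(1)
    by (simp add: special_def)
  then have "{q. special q \<and> inc q l \<and> sq q l = 12} = {p}"
    using p by blast
  then show ?thesis by simp
qed

text \<open>Each heavy line has four special points, exactly one of them of type 2220; each special point
  is on at most four heavy lines and is of type 2220 on at least one. So all these bounds are attained.\<close>

lemma heavy_counts:
  shows "card heavy_lines = card {p. special p}"
    and "special p \<Longrightarrow> card {l \<in> heavy_lines. inc p l} = 4"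
    and "special p \<Longrightarrow> card {l \<in> heavy_lines. inc p l \<and> sq p l = 12} = 1"
proof -
  have le4: "card {l \<in> heavy_lines. inc p l} \<le> 4" if p: "special p" for p
  proof -
    obtain l0 where l0: "inc p l0" "T l0 = 22"
      using special_tight[OF p] by blast
    then have "{l \<in> heavy_lines. inc p l} \<subseteq> {l. inc p l} - {l0}"
      by (auto simp: heavy_lines_def)
    then have "card {l \<in> heavy_lines. inc p l} \<le> card ({l. inc p l} - {l0})"
      by (intro card_mono) auto
    then show ?thesis
      using l0 lines_on[of p] by simp
  qed
  have ge1: "1 \<le> card {l \<in> heavy_lines. inc p l \<and> sq p l = 12}" if p: "special p" for p
  proof -
    have "{l \<in> heavy_lines. inc p l \<and> sq p l = 12} \<noteq> {}"
      using special_has_2220[OF p] p by (auto simp: heavy_lines_def)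
    then show ?thesis
      by (simp add: Suc_le_eq card_gt_0_iff)
  qed
  have s1: "(\<Sum>p | special p. card {l \<in> heavy_lines. inc p l}) = 4 * card heavy_lines"
    using sum_card_swap[of "{p. special p}" heavy_lines inc] heavy_card_special by simp
  have s2: "(\<Sum>p | special p. card {l \<in> heavy_lines. inc p l \<and> sq p l = 12}) = card heavy_lines"
    using sum_card_swap[of "{p. special p}" heavy_lines "\<lambda>p l. inc p l \<and> sq p l = 12"] heavy_unique by simp
  have "4 * card heavy_lines \<le> 4 * card {p. special p}"
    using s1 sum_bounded_above[of "{p. special p}" "\<lambda>p. card {l \<in> heavy_lines. inc p l}" 4] le4 by simp
  moreover have "card {p. special p} \<le> card heavy_lines"
    using s2 sum_bounded_below[of "{p. special p}" 1 "\<lambda>p. card {l \<in> heavy_lines. inc p l \<and> sq p l = 12}"] ge1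
    by simp
  ultimately show eq: "card heavy_lines = card {p. special p}"
    by simp
  show "card {l \<in> heavy_lines. inc p l} = 4" if "special p"
    using le4 s1 eq that
    by (intro sum_bound_tight[of "{p. special p}" "\<lambda>p. card {l \<in> heavy_lines. inc p l}" "\<lambda>_. 4"]) auto
  have "1 = card {l \<in> heavy_lines. inc p l \<and> sq p l = 12}" if "special p"
    using ge1 s2 eq that
    by (intro sum_bound_tight[of "{p. special p}" "\<lambda>_. 1" "\<lambda>p. card {l \<in> heavy_lines. inc p l \<and> sq p l = 12}"]) auto
  then show "card {l \<in> heavy_lines. inc p l \<and> sq p l = 12} = 1" if "special p"
    using that by simp
qed

text \<open>Only four line classes through \<open>p\<close> can have \<open>T = 26\<close>, and four
  heavy ones pass through \<open>p\<close>, so these coincide.\<close>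

lemma special_T26_heavy:
  assumes "special p" "inc p l" "T l = 26"
  shows "l \<in> heavy_lines"
proof -
  obtain l0 where l0: "inc p l0" "T l0 = 22"
    using special_tight[OF assms(1)] by blast
  have "{l \<in> heavy_lines. inc p l} \<subseteq> {l. inc p l} - {l0}"
    using l0 by (auto simp: heavy_lines_def)
  moreover have "card ({l. inc p l} - {l0}) = 4"
    using l0 lines_on[of p] by simp
  ultimately have "{l \<in> heavy_lines. inc p l} = {l. inc p l} - {l0}"
    using heavy_counts(2)[OF assms(1)] by (intro card_subset_eq) auto
  moreover have "l \<noteq> l0"
    using assms(3) l0(2) by auto
  ultimately show ?thesis
    using assms(2) by blast
qed

section \<open>Classes of six exist and are all special\<close>

lemma six_T26:
  assumes "u p = 6"
  obtains l where "inc p l" "T l = 26"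
proof -
  have le: "T l \<le> 26" if "inc p l" for l
    using T_le_mx[OF that] mx_ge_2[OF that] assms by simp
  have "\<exists>l. inc p l \<and> T l \<ge> 26"
  proof (rule ccontr)
    assume none: "\<not> ?thesis"
    have "T l \<le> 25" if "inc p l" for l
    proof -
      have "\<not> 26 \<le> T l"
        using none that by blast
      then show ?thesis by linarith
    qed
    then have "(\<Sum>l | inc p l. T l) \<le> card {l. inc p l} * 25"
      using sum_bounded_above[of "{l. inc p l}" T 25] by simp
    \<comment> \<open>The five values sum to 102 + 24 = 126 > 125.\<close>
    then show False
      using sum_T_on[of p] lines_on[of p] assms by simp
  qed
  then obtain l where "inc p l" "T l \<ge> 26" by blast
  with le[of l] that[of l] show thesis by simp
qed

text \<open>A class of six that is not special is of type 2220 here, so the line class has three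
  further classes of six, none of type 2220.\<close>

lemma special_on_T26:
  assumes "u p = 6" "\<not> special p" "inc p l" "T l = 26"
  obtains q where "inc q l" "special q"
proof -
  have sq: "sq p l = 12"
    using assms by (auto simp: special_def)
  have "card ({q. inc q l \<and> u q = 6} - {p}) = 3"
    using T26_2220_line(1)[OF assms(4,3,1) sq] assms by simp
  then have "{q. inc q l \<and> u q = 6} - {p} \<noteq> {}"
    by (metis card.empty zero_neq_numeral)
  then obtain q where q: "inc q l" "u q = 6" "q \<noteq> p"
    by blast
  have "sq q l \<noteq> 12"
    using T26_unique_2220[OF assms(4,3,1) sq] q by auto
  with q show thesis
    using that by (auto simp: special_def)
qed

lemma six_special:
  assumes "u p = 6"
  shows "special p"
proof (rule ccontr)
  assume ns: "\<not> special p"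
  obtain l where l: "inc p l" "T l = 26"
    using six_T26[OF assms] .
  obtain q where "inc q l" "special q"
    using special_on_T26[OF assms ns l] .
  then have "l \<in> heavy_lines"
    using special_T26_heavy l(2) by blast
  with ns show False
    using heavy_special l(1) assms by blast
qed

text \<open>Otherwise, since 4 * 21 < 102, some class has five points. Its line classes have sum 122
  > 120, so one has \<open>T \<ge> 25\<close> and consists of five fives.\<close>

lemma six_exists: "\<exists>p. u p = 6"
proof (rule ccontr)
  assume "\<not> ?thesis"
  then have ne6: "u p \<noteq> 6" for p by blast
  have le5: "u p \<le> 5" for p
    using u_le_6[of p] ne6[of p] by linarith
  have "\<exists>p. u p = 5"
  proof (rule ccontr)
    assume "\<not> ?thesis"
    then have ne5: "u p \<noteq> 5" for p by blast
    have "u p \<le> 4" for p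
      using le5[of p] ne5[of p] by linarith
    then show False
      using sum_bounded_above[of UNIV u 4] total_weight card_points by simp
  qed
  then obtain p where p: "u p = 5" by blast
  have "\<exists>l. inc p l \<and> T l \<ge> 25"
  proof (rule ccontr)
    assume none: "\<not> ?thesis"
    have "T l \<le> 24" if "inc p l" for l
    proof -
      have "\<not> 25 \<le> T l"
        using none that by blast
      then show ?thesis by linarith
    qed
    then have "(\<Sum>l | inc p l. T l) \<le> card {l. inc p l} * 24"
      using sum_bounded_above[of "{l. inc p l}" T 24] by simp
    then show False
      using sum_T_on[of p] lines_on[of p] p by simp
  qed
  then obtain l where l: "inc p l" "T l \<ge> 25" by blast
  have five: "u q = 5" if "inc q l" for q
    using that l(2) le5 points_on[of l]
    by (intro sum_bound_tight[of "{q. inc q l}" u "\<lambda>_. 5"]) (auto simp: T_def)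
  show False
    using net.all_five_impossible[OF net, of l] five five_directions
    by (simp add: net_wt sq_def)
qed

section \<open>Line classes with 22 arc points and the number of special classes\<close>

lemma special_T22_3300:
  assumes "special p" "inc p l" "T l = 22"
  shows "c p l i \<in> {0, 3}"
proof -
  have u: "u p = 6"
    using assms(1) by (simp add: special_def)
  obtain l0 where l0: "inc p l0" "\<And>i. c p l0 i \<le> 3"
    "\<And>l. inc p l \<Longrightarrow> l \<noteq> l0 \<Longrightarrow> T l = 26" "\<And>l i. inc p l \<Longrightarrow> l \<noteq> l0 \<Longrightarrow> c p l i \<le> 2"
    using special_tight[OF assms(1)] by blast
  then have ll0: "l = l0"
    using assms(2,3) by fastforce
  have "card {k \<in> heavy_lines. inc p k \<and> sq p k = 12} = 1"
    using heavy_counts(3)[OF assms(1)] .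
  then obtain k where k: "{k \<in> heavy_lines. inc p k \<and> sq p k = 12} = {k}"
    using card_1_singletonE by blast
  then have k': "inc p k" "sq p k = 12" "k \<noteq> l"
    using assms(3) by (auto simp: heavy_lines_def)
  have "sq p m = 10" if "m \<in> {l. inc p l} - {l} - {k}" for m
  proof -
    have "sq p m \<noteq> 12"
      using that k special_T26_heavy[OF assms(1), of m] l0(3)[of m] ll0 by auto
    then show ?thesis
      using sq_six_max2[OF u] l0(4) ll0 that by blast
  qed
  moreover have "card ({l. inc p l} - {l} - {k}) = 3"
    using lines_on[of p] assms(2) k' by simp
  ultimately have "(\<Sum>m\<in>{l. inc p l} - {l} - {k}. sq p m) = 30"
    by simp
  moreover have "(\<Sum>m | inc p m. sq p m) = sq p l + (\<Sum>m\<in>{l. inc p l} - {l}. sq p m)"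
    using assms(2) by (simp add: sum.remove)
  moreover have "(\<Sum>m\<in>{l. inc p l} - {l}. sq p m) = sq p k + (\<Sum>m\<in>{l. inc p l} - {l} - {k}. sq p m)"
    using k' by (intro sum.remove) auto
  \<comment> \<open>What remains of the total is 60 - 12 - 30.\<close>
  ultimately have "sq p l = 18"
    using sum_sq[of p] u k' by simp
  then show ?thesis
    using sum_squares_max3(4)[OF card_i, of "c p l0", OF l0(2)] weight[OF l0(1)] u ll0 by (simp add: sq_def)
qed

text \<open>Counting special classes on the five lines through \<open>p\<close>: four heavy ones
  carry four each, and \<open>p\<close> is counted five times. The bound 3 comes from 6 * 4 >
  22.\<close>

lemma card_special_T22:
  assumes "special p" "inc p l" "T l = 22"
  shows "card {q. special q \<and> inc q l} + 12 = card {q. special q}" "card {q. special q \<and> inc q l} \<le> 3"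
proof -
  obtain l0 where l0: "inc p l0" "\<And>l. inc p l \<Longrightarrow> l \<noteq> l0 \<Longrightarrow> T l = 26"
    using special_tight[OF assms(1)] by blast
  then have ll0: "l = l0"
    using assms(2,3) by fastforce
  define f where "f q = (if special q then 1 else 0 :: nat)" for q
  have f: "(\<Sum>q | inc q k. f q) = card {q. special q \<and> inc q k}" for k
    by (simp add: f_def sum.If_cases Collect_conj_eq Int_commute)
  have "(\<Sum>k\<in>{k. inc p k} - {l}. card {q. special q \<and> inc q k}) = (\<Sum>k\<in>{k. inc p k} - {l}. 4)"
    using l0(2) ll0 special_T26_heavy[OF assms(1)] heavy_card_special by (intro sum.cong) auto
  moreover have "(\<Sum>k | inc p k. card {q. special q \<and> inc q k}) =
      card {q. special q \<and> inc q l} + (\<Sum>k\<in>{k. inc p k} - {l}. card {q. special q \<and> inc q k})"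
    using assms(2) by (simp add: sum.remove)
  moreover have "(\<Sum>k | inc p k. card {q. special q \<and> inc q k}) = card {q. special q} + 4"
    using sum_lines_on[of f p] assms(1) unfolding f by (simp add: f_def sum.If_cases)
  ultimately show "card {q. special q \<and> inc q l} + 12 = card {q. special q}"
    using assms(2) lines_on[of p] by simp
  have "(\<Sum>q | special q \<and> inc q l. u q) \<le> T l"
    unfolding T_def by (intro sum_mono2) auto
  moreover have "(\<Sum>q | special q \<and> inc q l. u q) = card {q. special q \<and> inc q l} * 6"
    by (simp add: special_def)
  ultimately show "card {q. special q \<and> inc q l} \<le> 3"
    using assms(3) by simp
qed

definition light_lines :: "'l set" where
  "light_lines = {l. T l = 22 \<and> (\<exists>p. special p \<and> inc p l)}"

text \<open>Of n special classes, each is on one light line class, and a light line class carries n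
  - 12 of them.\<close>

lemma card_light_lines: "card light_lines * (card {q. special q} - 12) = card {q. special q}"
proof -
  have "card {l \<in> light_lines. inc p l} = 1" if sp: "special p" for p
  proof -
    obtain l0 where l0: "inc p l0" "T l0 = 22" "\<And>l. inc p l \<Longrightarrow> l \<noteq> l0 \<Longrightarrow> T l = 26"
      using special_tight[OF sp] by blast
    then have "{l \<in> light_lines. inc p l} = {l0}"
      using sp by (fastforce simp: light_lines_def)
    then show ?thesis by simp
  qed
  then have "(\<Sum>p | special p. card {l \<in> light_lines. inc p l}) = card {q. special q}"
    by simp
  moreover have "card {q. special q \<and> inc q l} = card {q. special q} - 12" if l: "l \<in> light_lines" for l
  proof -
    obtain p where "special p" "inc p l" "T l = 22"
      using l by (auto simp: light_lines_def)
    from card_special_T22(1)[OF this] show ?thesis by linarith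
  qed
  ultimately show ?thesis
    using sum_card_swap[of "{p. special p}" light_lines inc] by simp
qed

lemma special_exists: "\<exists>p. special p"
  using six_exists six_special by blast

text \<open>For n = 13 there would be 13 + 13 > 21 line classes. For n = 14 the 14 heavy and 7 light
  ones exhaust the plane, but their \<open>T\<close> sum to 518 instead of 510.\<close>

lemma card_special_eq_15: "card {p. special p} = 15"
proof -
  obtain p l where pl: "special p" "inc p l" "T l = 22"
    using special_exists special_tight by blast
  have "card {q. special q \<and> inc q l} > 0"
    using pl by (auto simp: card_gt_0_iff)
  with card_special_T22[OF pl] consider "card {p. special p} = 13" | "card {p. special p} = 14"
    | "card {p. special p} = 15"
    by linarith
  moreover have disj: "heavy_lines \<inter> light_lines = {}"
    by (auto simp: heavy_lines_def light_lines_def)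
  have BC: "card (heavy_lines \<union> light_lines) = card {p. special p} + card light_lines"
    using card_Un_disjoint[of heavy_lines light_lines] disj heavy_counts(1) by simp
  have "card (heavy_lines \<union> light_lines) \<le> 21"
    using card_mono[of UNIV "heavy_lines \<union> light_lines"] card_lines by simp
  have False if 14: "card {p. special p} = 14"
  proof -
    have "card light_lines = 7"
      using card_light_lines 14 by simp
    then have "heavy_lines \<union> light_lines = UNIV"
      using BC 14 card_lines by (intro card_subset_eq) auto
    then have "sum T heavy_lines + sum T light_lines = 510"
      using sum_T disj by (metis finite sum.union_disjoint)
    moreover have "sum T heavy_lines = card heavy_lines * 26" "sum T light_lines = card light_lines * 22"
      by (simp_all add: heavy_lines_def light_lines_def)
    ultimately show False
      using 14 heavy_counts(1) \<open>card light_lines = 7\<close> by simp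
  qed
  ultimately show ?thesis
    using card_light_lines BC \<open>card (heavy_lines \<union> light_lines) \<le> 21\<close> by cases auto
qed

text \<open>Besides three special classes, \<open>l\<close> has two classes \<open>a\<close>,
  \<open>b\<close> with four points together. A special class \<open>w\<close> off \<open>l\<close>
  has one line class without \<open>T = 26\<close>, so its join to \<open>a\<close> or
  \<open>b\<close> is heavy. Hence both have two points, and \<open>three_3300_impossible\<close>
  applies.\<close>

lemma no_arc_weights: False
proof -
  obtain p l where pl: "special p" "inc p l" "T l = 22"
    using special_exists special_tight by blast
  have "card {q. special q \<and> inc q l} = 3"
    using card_special_T22(1)[OF pl] card_special_eq_15 by simp
  then obtain x y z where xyz: "{q. special q \<and> inc q l} = {x, y, z}" "x \<noteq> y" "y \<noteq> z" "x \<noteq> z"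
    by (auto simp: card_3_iff)
  have "{q. inc q l} = {q. special q \<and> inc q l} \<union> {q. inc q l \<and> \<not> special q}"
    by auto
  then have "card {q. inc q l \<and> \<not> special q} = 2"
    using points_on[of l] \<open>card {q. special q \<and> inc q l} = 3\<close>
      card_Un_disjoint[of "{q. special q \<and> inc q l}" "{q. inc q l \<and> \<not> special q}"] by auto
  then obtain a b where ab: "{q. inc q l \<and> \<not> special q} = {a, b}" "a \<noteq> b"
    by (auto simp: card_2_iff)
  have A: "{q. inc q l} = {x, y, z, a, b}"
    using xyz(1) ab(1) by blast
  have d: "distinct [x, y, z, a, b]"
    using xyz ab by auto
  have six: "special v" "inc v l" "u v = 6" if "v \<in> {x, y, z}" for v
    using that xyz(1) by (auto simp: special_def)
  have "T l = u x + u y + u z + u a + u b"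
    unfolding T_def A using d by simp
  then have sum4: "u a + u b = 4"
    using pl(3) six(3)[of x] six(3)[of y] six(3)[of z] by simp
  have "\<not> {q. special q} \<subseteq> {q. special q \<and> inc q l}"
    using card_mono[of "{q. special q \<and> inc q l}" "{q. special q}"] card_special_eq_15
      \<open>card {q. special q \<and> inc q l} = 3\<close> by auto
  then obtain w where w: "special w" "\<not> inc w l"
    by blast
  have inc_ab: "inc a l" "inc b l" "\<not> special a" "\<not> special b"
    using ab by auto
  obtain la lb where la: "inc w la" "inc a la" and lb: "inc w lb" "inc b lb"
    using join[of w a] join[of w b] w inc_ab by blast
  have "la \<noteq> lb"
    using join[OF ab(2)] la lb inc_ab w by blast
  moreover obtain l0 where "\<And>k. inc w k \<Longrightarrow> k \<noteq> l0 \<Longrightarrow> T k = 26"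
    using special_tight[OF w(1)] by blast
  ultimately have "T la = 26 \<or> T lb = 26"
    using la(1) lb(1) by blast
  then have "u a = 2 \<or> u b = 2"
    using special_T26_heavy[OF w(1)] heavy_two la lb inc_ab by blast
  then have "u a = 2" "u b = 2"
    using sum4 by auto
  then have wt: "net.total {q. inc q l} (\<lambda>p. c p l) = 22" "net.wt (\<lambda>p. c p l) a = 2"
    "net.wt (\<lambda>p. c p l) b = 2"
    using net_total[of l] net_wt[OF inc_ab(1)] net_wt[OF inc_ab(2)] pl(3) by simp_all
  have wt6: "net.wt (\<lambda>p. c p l) v = 6" if "v \<in> {x, y, z}" for v
    using net_wt[OF six(2)[OF that]] six(3)[OF that] by simp
  have c03: "c v l i \<in> {0, 3}" if "v \<in> {x, y, z}" for v i
    using special_T22_3300[OF six(1,2)[OF that] pl(3)] .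
  show False
    by (rule net.three_3300_impossible[OF net wt(1) A d wt6 wt(2,3) c03])
qed

end

section \<open>Coordinates over the chain rings\<close>

lemma gf4_add_eq_iff: "(a::gf4) + b = d \<longleftrightarrow> a = b + d"
  by (metis add.assoc add.commute add.left_neutral gf4_add_self)

text \<open>The pair \<open>(x, e)\<close> stands for the point with coordinate vector \<open>x + e \<theta>\<close> over a chain ring with
  maximal ideal generated by \<open>\<theta>\<close>, where \<open>\<theta> a = \<sigma>(a) \<theta>\<close>, and \<open>(a, f)\<close> for the line with equation \<open>(a + f \<theta>) w = 0\<close>.
  Only the carries \<open>\<gamma>\<close> depend on the ring, and they merely relabel the segments.\<close>

lemma card_model_arc_le:
  fixes K :: "(pg \<times> gf4 \<times> gf4) set" and \<sigma> :: "gf4 \<Rightarrow> gf4"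
  assumes \<sigma>: "\<sigma> = (\<lambda>a. a) \<or> \<sigma> = (\<lambda>a. a * a)"
    and arc: "\<And>a f. card {(x, e) \<in> K. pg_inc x a \<and>
      dot (coords a) (offpivot x e) = dot (offpivot a f) (map3 \<sigma> (coords x)) + \<gamma> a x} \<le> 7"
  shows "card K \<le> 101"
proof (rule ccontr)
  assume "\<not> card K \<le> 101"
  then have "102 \<le> card K" by simp
  \<comment> \<open>The counts need the total to be exactly 102; the bound on lines passes to
    subsets.\<close>
  then obtain M where M: "M \<subseteq> K" "card M = 102"
    by (rule obtain_subset_with_card_n) auto
  define E where "E x = {e. (x, e) \<in> M}" for x
  \<comment> \<open>\<open>v x a e\<close> is the segment in direction \<open>a\<close> containing
    the point \<open>(x, e)\<close>, and \<open>s a x f\<close> is the segment of the class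
    \<open>x\<close> on the line \<open>(a, f)\<close>.\<close>
  define v where "v x a e = dot (coords a) (offpivot x e)" for x a e
  define c where "c x a i = card {e \<in> E x. v x a e = i}" for x a i
  define s where "s a x f = dot (offpivot a f) (map3 \<sigma> (coords x)) + \<gamma> a x" for a x f
  have v_eq_iff: "v x a (e, e') = v x a (d, d') \<longleftrightarrow> dot (coords a) (offpivot x (e + d, e' + d')) = 0"
    for x a e e' d d'
    unfolding v_def dot_offpivot_add gf4_add_eq_0_iff ..
  have s_inj: "f = g" if "s a x f = s a x g" "s a y f = s a y g" "pg_inc x a" "pg_inc y a" "x \<noteq> y"
    for a x y f g
  proof (rule ccontr)
    assume "f \<noteq> g"
    obtain f1 f2 g1 g2 where fg: "f = (f1, f2)" "g = (g1, g2)"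
      by fastforce
    have z: "dot (offpivot a (f1 + g1, f2 + g2)) w = 0"
      if "dot (offpivot a f) w = dot (offpivot a g) w" for w
      using that unfolding fg dot_commute[of _ w] dot_offpivot_add gf4_add_eq_0_iff .
    have "(f1 + g1, f2 + g2) \<noteq> (0, 0)"
      using \<open>f \<noteq> g\<close> by (simp add: fg gf4_add_eq_0_iff)
    from pg_unique_twisted_zero[OF this \<sigma> that(3) z that(4) z] that(1,2,5) show False
      by (simp add: s_def)
  qed
  interpret arc_weights pg_inc c s "\<lambda>x. card (E x)"
  proof (rule arc_weights.intro)
    show "CARD(pg) = 21" "CARD(pg) = 21" by (rule card_pg)+
    show "card {l. pg_inc p l} = 5" for p by (rule card_pg_lines_on)
    show "\<exists>!l. pg_inc p l \<and> pg_inc q l" if "p \<noteq> q" for p q by (rule pg_join[OF that])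
    show "net {p. pg_inc p l} (\<lambda>p. c p l) (s l)" for l
    proof
      show "card {p. pg_inc p l} = 5" by (rule card_pg_points_on)
      show "CARD(gf4) = 4" by (rule card_gf4)
      show "bij (\<lambda>f. (s l x f, s l y f))"
        if "x \<in> {p. pg_inc p l}" "y \<in> {p. pg_inc p l}" "x \<noteq> y" for x y
      proof -
        have "inj (\<lambda>f. (s l x f, s l y f))"
          using s_inj[of l x _ _ y] that by (auto intro!: injI)
        then show ?thesis
          using finite_UNIV_inj_surj[OF finite] by (simp add: bij_def)
      qed
      show "(\<Sum>x\<in>{p. pg_inc p l}. c x l (s l x f)) \<le> 7" for f
      proof -
        have "(\<Sum>x\<in>{p. pg_inc p l}. c x l (s l x f))
            = card (Sigma {p. pg_inc p l} (\<lambda>x. {e \<in> E x. v x l e = s l x f}))"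
          by (simp add: c_def)
        also have "\<dots> \<le> card {(x, e) \<in> K. pg_inc x l \<and>
            dot (coords l) (offpivot x e) = dot (offpivot l f) (map3 \<sigma> (coords x)) + \<gamma> l x}"
          using M(1) by (intro card_mono) (auto simp: E_def v_def s_def)
        also have "\<dots> \<le> 7" by (rule arc)
        finally show ?thesis .
      qed
    qed
    show "sum (c p l) UNIV = card (E p)" if "pg_inc p l" for p l
      using sum_card_swap[of UNIV "E p" "\<lambda>i e. v p l e = i"] by (simp add: c_def)
    show "(\<Sum>p\<in>UNIV. card (E p)) = 102"
    proof -
      have "M = Sigma UNIV E"
        by (auto simp: E_def)
      then show ?thesis
        using M(2) by simp
    qed
    show "(\<Sum>l | pg_inc p l. \<Sum>i\<in>UNIV. (c p l i)\<^sup>2) = (card (E p))\<^sup>2 + 4 * card (E p)" for p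
    proof -
      define L where "L = {l. pg_inc p l}"
      \<comment> \<open>Ordered pairs of arc points are counted by common segments: equal points
        share five, distinct points one.\<close>
      have "(\<Sum>l\<in>L. \<Sum>i\<in>UNIV. (c p l i)\<^sup>2)
          = (\<Sum>(l, i)\<in>L \<times> UNIV. card {(e, d) \<in> E p \<times> E p. v p l e = i \<and> v p l d = i})"
      proof -
        have "{(e, d) \<in> E p \<times> E p. v p l e = i \<and> v p l d = i}
            = {e \<in> E p. v p l e = i} \<times> {e \<in> E p. v p l e = i}" for l i
          by auto
        then show ?thesis
          by (simp add: sum.cartesian_product c_def power2_eq_square card_cartesian_product)
      qed
      also have "\<dots> = (\<Sum>(e, d)\<in>E p \<times> E p. card {(l, i) \<in> L \<times> UNIV. v p l e = i \<and> v p l d = i})"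
        using sum_card_swap[of "L \<times> UNIV" "E p \<times> E p"
            "\<lambda>(l, i) (e, d). v p l e = i \<and> v p l d = i"]
        by (simp add: case_prod_unfold mem_Times_iff conj_assoc)
      also have "\<dots> = (\<Sum>(e, d)\<in>E p \<times> E p. 1 + (if e = d then 4 else 0))"
      proof (intro sum.cong refl, clarify)
        fix e1 e2 d1 d2
        have "{(l, i) \<in> L \<times> UNIV. v p l (e1, e2) = i \<and> v p l (d1, d2) = i}
            = (\<lambda>l. (l, v p l (e1, e2))) ` {l \<in> L. v p l (e1, e2) = v p l (d1, d2)}"
          by auto
        then have "card {(l, i) \<in> L \<times> UNIV. v p l (e1, e2) = i \<and> v p l (d1, d2) = i}
            = card {l \<in> L. v p l (e1, e2) = v p l (d1, d2)}"
          by (simp add: card_image inj_on_def)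
        also have "\<dots> = 1 + (if (e1, e2) = (d1, d2) then 4 else 0)"
        proof (cases "(e1, e2) = (d1, d2)")
          case True
          then show ?thesis
            using card_pg_lines_on[of p] by (simp add: L_def)
        next
          case False
          then have "(e1 + d1, e2 + d2) \<noteq> (0, 0)"
            by (simp add: gf4_add_eq_0_iff)
          from pg_unique_direction[OF this, of p] show ?thesis
            using False unfolding v_eq_iff L_def by simp
        qed
        finally show "card {(l, i) \<in> L \<times> UNIV. v p l (e1, e2) = i \<and> v p l (d1, d2) = i}
            = 1 + (if (e1, e2) = (d1, d2) then 4 else 0)" .
      qed
      also have "\<dots> = (\<Sum>e\<in>E p. \<Sum>d\<in>E p. 1 + (if e = d then 4 else 0))"
        by (simp add: sum.cartesian_product)
      also have "\<dots> = (card (E p))\<^sup>2 + 4 * card (E p)"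
        unfolding sum.distrib by (simp add: power2_eq_square)
      finally show ?thesis by (simp add: L_def)
    qed
  qed
  show False by (rule no_arc_weights)
qed

section \<open>Normal forms of points and lines over a chain ring\<close>

text \<open>The element \<open>\<phi> a b\<close> stands for \<open>a + b \<theta>\<close> with fixed representatives of the residue field;
  \<open>\<kappa>\<close> and \<open>\<mu>\<close> are the carries of their sums and products.\<close>

locale twisted_double_gf4 =
  fixes R :: "('a, 'b) ring_scheme" (structure)
    and \<phi> :: "gf4 \<Rightarrow> gf4 \<Rightarrow> 'a" and \<sigma> :: "gf4 \<Rightarrow> gf4" and \<kappa> \<mu> :: "gf4 \<Rightarrow> gf4 \<Rightarrow> gf4"
  assumes carrier_eq: "carrier R = {\<phi> a b | a b. True}"
    and \<phi>_eq_iff: "\<phi> a b = \<phi> a' b' \<longleftrightarrow> a = a' \<and> b = b'"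
    and zero_eq: "\<zero> = \<phi> 0 0" and one_eq: "\<one> = \<phi> 1 0"
    and add_eq: "\<phi> a b \<oplus> \<phi> a' b' = \<phi> (a + a') (b + b' + \<kappa> a a')"
    and mult_eq: "\<phi> a b \<otimes> \<phi> a' b' = \<phi> (a * a') (a * b' + b * \<sigma> a' + \<mu> a a')"
    and \<sigma>_cases: "\<sigma> = (\<lambda>a. a) \<or> \<sigma> = (\<lambda>a. a * a)"
    and \<kappa>_0 [simp]: "\<kappa> a 0 = 0" "\<kappa> 0 a = 0"
    and \<mu>_0 [simp]: "\<mu> a 0 = 0" "\<mu> 0 a = 0"
    and \<mu>_1 [simp]: "\<mu> a 1 = 0" "\<mu> 1 a = 0"
    and \<mu>_cocycle: "a * \<mu> b d + \<mu> a (b * d) = \<mu> a b * \<sigma> d + \<mu> (a * b) d"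
    and \<kappa>_\<mu>: "\<kappa> a b * \<sigma> d + \<mu> (a + b) d = \<mu> a d + \<mu> b d + \<kappa> (a * d) (b * d)"
begin

lemma \<sigma>_simps [simp]: "\<sigma> 0 = 0" "\<sigma> 1 = 1" "\<sigma> (a * b) = \<sigma> a * \<sigma> b"
  using \<sigma>_cases by (auto simp: ac_simps)

lemma \<phi>_carrier [simp]: "\<phi> a b \<in> carrier R"
  using carrier_eq by blast

lemma carrierE:
  assumes "x \<in> carrier R"
  obtains a b where "x = \<phi> a b"
  using assms carrier_eq by blast

text \<open>\<open>\<mu>_cocycle\<close> is the \<theta>-component of this identity; likewise
  \<open>\<kappa>_\<mu>\<close> for \<open>right_distrib\<close>.\<close>

lemma mult_assoc:
  assumes "x \<in> carrier R" "y \<in> carrier R" "z \<in> carrier R"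
  shows "x \<otimes> y \<otimes> z = x \<otimes> (y \<otimes> z)"
proof -
  obtain a a' b b' d d' where "x = \<phi> a a'" "y = \<phi> b b'" "z = \<phi> d d'"
    using assms carrierE by metis
  then show ?thesis
    using \<mu>_cocycle[of a b d] by (simp add: mult_eq \<phi>_eq_iff algebra_simps)
qed

lemma right_distrib:
  assumes "x \<in> carrier R" "y \<in> carrier R" "z \<in> carrier R"
  shows "(x \<oplus> y) \<otimes> z = x \<otimes> z \<oplus> y \<otimes> z"
proof -
  obtain a a' b b' d d' where "x = \<phi> a a'" "y = \<phi> b b'" "z = \<phi> d d'"
    using assms carrierE by metis
  then show ?thesis
    using \<kappa>_\<mu>[of a b d] by (simp add: mult_eq add_eq \<phi>_eq_iff algebra_simps)
qed

lemma mult_closed [simp]: "x \<in> carrier R \<Longrightarrow> y \<in> carrier R \<Longrightarrow> x \<otimes> y \<in> carrier R"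
  by (metis carrierE mult_eq \<phi>_carrier)

lemma add_closed [simp]: "x \<in> carrier R \<Longrightarrow> y \<in> carrier R \<Longrightarrow> x \<oplus> y \<in> carrier R"
  by (metis carrierE add_eq \<phi>_carrier)

lemma unit_simps [simp]:
  assumes "x \<in> carrier R"
  shows "x \<otimes> \<one> = x" "\<one> \<otimes> x = x" "x \<oplus> \<zero> = x" "\<zero> \<oplus> x = x" "\<zero> \<otimes> x = \<zero>"
  using assms by (auto elim!: carrierE simp: zero_eq one_eq add_eq mult_eq)

lemma zero_one_closed [simp]: "\<zero> \<in> carrier R" "\<one> \<in> carrier R"
  by (simp_all add: zero_eq one_eq)

lemma right_inverse:
  assumes "a \<noteq> 0"
  obtains d d' where "d \<noteq> 0" "\<phi> a b \<otimes> \<phi> d d' = \<one>"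
proof -
  obtain d where d: "a * d = 1"
    using gf4_inverse_exists[OF assms] by blast
  have "a * (d * (b * \<sigma> d + \<mu> a d)) = b * \<sigma> d + \<mu> a d"
    using d by (simp add: mult.assoc[symmetric])
  \<comment> \<open>The second coordinate solves a d' + b \<sigma>(d) + \<mu>(a, d) = 0 in
    characteristic 2.\<close>
  then have "\<phi> a b \<otimes> \<phi> d (d * (b * \<sigma> d + \<mu> a d)) = \<one>"
    using d by (simp add: mult_eq one_eq \<phi>_eq_iff add.assoc gf4_add_eq_0_iff mult_2)
  moreover have "d \<noteq> 0"
    using d by auto
  ultimately show thesis
    using that by blast
qed

fun lift :: "gf4 \<times> gf4 \<times> gf4 \<Rightarrow> gf4 \<times> gf4 \<times> gf4 \<Rightarrow> 'a \<times> 'a \<times> 'a" where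
  "lift (x, y, z) (e, e', e'') = (\<phi> x e, \<phi> y e', \<phi> z e'')"

definition point :: "pg \<Rightarrow> gf4 \<times> gf4 \<Rightarrow> ('a \<times> 'a \<times> 'a) set" where
  "point x e = {vsmul R (lift (coords x) (offpivot x e)) r | r. r \<in> carrier R}"

text \<open>Solving for the pivot coordinate avoids negation in \<open>R\<close> and yields a basis
  at once; coefficients before the pivot lie in the maximal ideal.\<close>

fun on_line :: "pg \<Rightarrow> gf4 \<times> gf4 \<Rightarrow> 'a \<times> 'a \<times> 'a \<Rightarrow> bool" where
  "on_line (P1 b d) (f, f') (x, y, z) \<longleftrightarrow> x = \<phi> b f \<otimes> y \<oplus> \<phi> d f' \<otimes> z"
| "on_line (P2 d) (f, f') (x, y, z) \<longleftrightarrow> y = \<phi> 0 f \<otimes> x \<oplus> \<phi> d f' \<otimes> z"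
| "on_line P3 (f, f') (x, y, z) \<longleftrightarrow> z = \<phi> 0 f \<otimes> x \<oplus> \<phi> 0 f' \<otimes> y"

definition line :: "pg \<Rightarrow> gf4 \<times> gf4 \<Rightarrow> ('a \<times> 'a \<times> 'a) set" where
  "line a f = {w \<in> vecs R. on_line a f w}"

fun carry :: "pg \<Rightarrow> gf4 \<times> gf4 \<times> gf4 \<Rightarrow> gf4" where
  "carry (P1 b d) (x, y, z) = \<mu> b y + \<mu> d z + \<kappa> (b * y) (d * z)"
| "carry (P2 d) (x, y, z) = \<mu> d z"
| "carry P3 (x, y, z) = 0"

text \<open>The residues give incidence in the plane of order 4, the \<theta>-components give the
  segment; \<open>carry\<close> collects what depends on neither \<open>e\<close> nor
  \<open>f\<close>.\<close>

lemma on_line_lift_iff: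
  "on_line a f (lift w e) \<longleftrightarrow> dot (coords a) w = 0 \<and>
    dot (coords a) e = dot (offpivot a f) (map3 \<sigma> w) + carry a w"
proof -
  obtain x y z where w: "w = (x, y, z)" by (cases w)
  obtain e1 e2 e3 where e: "e = (e1, e2, e3)" by (cases e)
  obtain f1 f2 where f: "f = (f1, f2)" by (cases f)
  show ?thesis
    by (cases a) (simp_all add: w e f mult_eq add_eq \<phi>_eq_iff add.assoc gf4_add_eq_iff, (simp_all add: ac_simps)?)
qed

lemma span2_cong:
  assumes "\<And>r s. r \<in> carrier R \<Longrightarrow> s \<in> carrier R \<Longrightarrow> vadd R (vsmul R x r) (vsmul R y s) = h r s"
  shows "{vadd R (vsmul R x r) (vsmul R y s) | r s. r \<in> carrier R \<and> s \<in> carrier R}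
    = {h r s | r s. r \<in> carrier R \<and> s \<in> carrier R}"
  using assms by (intro Collect_cong) metis

text \<open>Basis vectors have (1, 0) and (0, 1) at the two coordinates off the pivot, which recover
  the scalars.\<close>

lemma line_mem_hlines: "line a f \<in> hlines R"
proof -
  obtain f1 f2 where f: "f = (f1, f2)" by (cases f)
  have "\<exists>x\<in>vecs R. \<exists>y\<in>vecs R.
     (line a f = {vadd R (vsmul R x r) (vsmul R y s) | r s. r \<in> carrier R \<and> s \<in> carrier R}) \<and>
     (\<forall>r\<in>carrier R. \<forall>s\<in>carrier R.
        vadd R (vsmul R x r) (vsmul R y s) = vzero R \<longrightarrow> r = \<zero> \<and> s = \<zero>)"
  proof (cases a)
    case (P1 b d)
    have h: "vadd R (vsmul R (\<phi> b f1, \<one>, \<zero>) r) (vsmul R (\<phi> d f2, \<zero>, \<one>) s) = (\<phi> b f1 \<otimes> r \<oplus> \<phi> d f2 \<otimes> s, r, s)"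
      if "r \<in> carrier R" "s \<in> carrier R" for r s
      using that by (simp add: vadd_def vsmul_def)
    have "line a f = {(\<phi> b f1 \<otimes> r \<oplus> \<phi> d f2 \<otimes> s, r, s) | r s. r \<in> carrier R \<and> s \<in> carrier R}"
      by (auto simp: P1 f line_def vecs_def)
    also note span2_cong[OF h, symmetric]
    finally have line: "line a f = {vadd R (vsmul R (\<phi> b f1, \<one>, \<zero>) r) (vsmul R (\<phi> d f2, \<zero>, \<one>) s) | r s.
      r \<in> carrier R \<and> s \<in> carrier R}" .
    show ?thesis
    proof (intro bexI conjI ballI impI)
      show "line a f = {vadd R (vsmul R (\<phi> b f1, \<one>, \<zero>) r) (vsmul R (\<phi> d f2, \<zero>, \<one>) s) | r s.
        r \<in> carrier R \<and> s \<in> carrier R}" by (rule line)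
    qed (auto simp: h vzero_def vecs_def)
  next
    case (P2 d)
    have h: "vadd R (vsmul R (\<one>, \<phi> 0 f1, \<zero>) r) (vsmul R (\<zero>, \<phi> d f2, \<one>) s) = (r, \<phi> 0 f1 \<otimes> r \<oplus> \<phi> d f2 \<otimes> s, s)"
      if "r \<in> carrier R" "s \<in> carrier R" for r s
      using that by (simp add: vadd_def vsmul_def)
    have "line a f = {(r, \<phi> 0 f1 \<otimes> r \<oplus> \<phi> d f2 \<otimes> s, s) | r s. r \<in> carrier R \<and> s \<in> carrier R}"
      by (auto simp: P2 f line_def vecs_def)
    also note span2_cong[OF h, symmetric]
    finally have line: "line a f = {vadd R (vsmul R (\<one>, \<phi> 0 f1, \<zero>) r) (vsmul R (\<zero>, \<phi> d f2, \<one>) s) | r s.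
      r \<in> carrier R \<and> s \<in> carrier R}" .
    show ?thesis
    proof (intro bexI conjI ballI impI)
      show "line a f = {vadd R (vsmul R (\<one>, \<phi> 0 f1, \<zero>) r) (vsmul R (\<zero>, \<phi> d f2, \<one>) s) | r s.
        r \<in> carrier R \<and> s \<in> carrier R}" by (rule line)
    qed (auto simp: h vzero_def vecs_def)
  next
    case P3
    have h: "vadd R (vsmul R (\<one>, \<zero>, \<phi> 0 f1) r) (vsmul R (\<zero>, \<one>, \<phi> 0 f2) s) = (r, s, \<phi> 0 f1 \<otimes> r \<oplus> \<phi> 0 f2 \<otimes> s)"
      if "r \<in> carrier R" "s \<in> carrier R" for r s
      using that by (simp add: vadd_def vsmul_def)
    have "line a f = {(r, s, \<phi> 0 f1 \<otimes> r \<oplus> \<phi> 0 f2 \<otimes> s) | r s. r \<in> carrier R \<and> s \<in> carrier R}"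
      by (auto simp: P3 f line_def vecs_def)
    also note span2_cong[OF h, symmetric]
    finally have line: "line a f = {vadd R (vsmul R (\<one>, \<zero>, \<phi> 0 f1) r) (vsmul R (\<zero>, \<one>, \<phi> 0 f2) s) | r s.
      r \<in> carrier R \<and> s \<in> carrier R}" .
    show ?thesis
    proof (intro bexI conjI ballI impI)
      show "line a f = {vadd R (vsmul R (\<one>, \<zero>, \<phi> 0 f1) r) (vsmul R (\<zero>, \<one>, \<phi> 0 f2) s) | r s.
        r \<in> carrier R \<and> s \<in> carrier R}" by (rule line)
    qed (auto simp: h vzero_def vecs_def)
  qed
  then show ?thesis
    unfolding hlines_def by blast
qed

lemma line_smul_closed:
  assumes "w \<in> line a f" "r \<in> carrier R"
  shows "vsmul R w r \<in> line a f"
proof -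
  obtain x y z where w: "w = (x, y, z)" by (cases w)
  obtain f1 f2 where f: "f = (f1, f2)" by (cases f)
  show ?thesis
    using assms by (cases a) (auto simp: w f line_def vecs_def vsmul_def right_distrib mult_assoc)
qed

lemma lift_vecs: "lift w e \<in> vecs R"
  by (cases w; cases e) (auto simp: vecs_def)

lemma point_subset_line:
  assumes "pg_inc x a"
    "dot (coords a) (offpivot x e) = dot (offpivot a f) (map3 \<sigma> (coords x)) + carry a (coords x)"
  shows "point x e \<subseteq> line a f"
proof -
  have "lift (coords x) (offpivot x e) \<in> line a f"
    using assms lift_vecs on_line_lift_iff by (simp add: line_def pg_inc_def)
  then show ?thesis
    unfolding point_def using line_smul_closed by blast
qed

lemma vsmul_assoc:
  assumes "w \<in> vecs R" "r \<in> carrier R" "t \<in> carrier R"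
  shows "vsmul R (vsmul R w r) t = vsmul R w (r \<otimes> t)"
  using assms by (auto simp: vecs_def vsmul_def mult_assoc)

lemma span_smul_unit:
  assumes "w \<in> vecs R" "d \<noteq> 0"
  shows "{vsmul R (vsmul R w (\<phi> d d')) r | r. r \<in> carrier R} = {vsmul R w r | r. r \<in> carrier R}"
proof -
  obtain t where t: "t \<in> carrier R" "\<phi> d d' \<otimes> t = \<one>"
    using right_inverse[OF assms(2)] by (metis \<phi>_carrier)
  have "vsmul R w r = vsmul R (vsmul R w (\<phi> d d')) (t \<otimes> r)" if "r \<in> carrier R" for r
    using that t assms(1) by (simp add: vsmul_assoc mult_assoc[symmetric])
  moreover have "vsmul R (vsmul R w (\<phi> d d')) r = vsmul R w (\<phi> d d' \<otimes> r)" if "r \<in> carrier R" for r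
    using that assms(1) by (simp add: vsmul_assoc)
  ultimately show ?thesis
    using t(1) by (blast intro: mult_closed \<phi>_carrier)
qed

text \<open>A generator of a free module has a unit coordinate; multiplying by the inverse of the
  first one normalises it.\<close>

lemma hpoints_eq_point:
  assumes "P \<in> hpoints R"
  obtains x e where "P = point x e"
proof -
  obtain w where w: "w \<in> vecs R" "P = {vsmul R w r | r. r \<in> carrier R}"
    and free: "\<And>r. r \<in> carrier R \<Longrightarrow> vsmul R w r = vzero R \<Longrightarrow> r = \<zero>"
    using assms unfolding hpoints_def by blast
  obtain x1 e1 x2 e2 x3 e3 where w_eq: "w = (\<phi> x1 e1, \<phi> x2 e2, \<phi> x3 e3)"
    using w(1) by (auto simp: vecs_def elim!: carrierE)
  have nz: "x1 \<noteq> 0 \<or> x2 \<noteq> 0 \<or> x3 \<noteq> 0"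
  proof (rule ccontr)
    assume "\<not> ?thesis"
    \<comment> \<open>\<open>\<phi> 0 1\<close> is \<theta>, which annihilates the maximal
      ideal.\<close>
    then have "vsmul R w (\<phi> 0 1) = vzero R"
      by (simp add: w_eq vsmul_def vzero_def mult_eq zero_eq)
    then show False
      using free[of "\<phi> 0 1"] by (simp add: zero_eq \<phi>_eq_iff)
  qed
  have "\<exists>d d' x e. d \<noteq> 0 \<and> vsmul R w (\<phi> d d') = lift (coords x) (offpivot x e)"
  proof (cases "x1 = 0")
    case False
    then obtain d d' where d: "d \<noteq> 0" "\<phi> x1 e1 \<otimes> \<phi> d d' = \<phi> 1 0"
      using right_inverse one_eq by metis
    then have "vsmul R w (\<phi> d d') = lift (coords (P1 (x2 * d) (x3 * d)))
      (offpivot (P1 (x2 * d) (x3 * d)) (x2 * d' + e2 * \<sigma> d + \<mu> x2 d, x3 * d' + e3 * \<sigma> d + \<mu> x3 d))"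
      by (simp add: w_eq vsmul_def mult_eq)
    with d show ?thesis by blast
  next
    case x1: True
    show ?thesis
    proof (cases "x2 = 0")
      case False
      then obtain d d' where d: "d \<noteq> 0" "\<phi> x2 e2 \<otimes> \<phi> d d' = \<phi> 1 0"
        using right_inverse one_eq by metis
      then have "vsmul R w (\<phi> d d') = lift (coords (P2 (x3 * d)))
        (offpivot (P2 (x3 * d)) (e1 * \<sigma> d, x3 * d' + e3 * \<sigma> d + \<mu> x3 d))"
        by (simp add: w_eq x1 vsmul_def mult_eq)
      with d show ?thesis by blast
    next
      case x2: True
      then obtain d d' where d: "d \<noteq> 0" "\<phi> x3 e3 \<otimes> \<phi> d d' = \<phi> 1 0"
        using nz x1 right_inverse one_eq by metis
      then have "vsmul R w (\<phi> d d') = lift (coords P3) (offpivot P3 (e1 * \<sigma> d, e2 * \<sigma> d))"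
        by (simp add: w_eq x1 x2 vsmul_def mult_eq)
      with d show ?thesis by blast
    qed
  qed
  then obtain d d' x e where "d \<noteq> 0" "vsmul R w (\<phi> d d') = lift (coords x) (offpivot x e)"
    by blast
  with span_smul_unit[OF w(1), of d d'] w(2) have "P = point x e"
    by (simp add: point_def)
  then show thesis by (rule that)
qed

lemma proj_arc_7_le:
  assumes "proj_arc R K k 7"
  shows "k \<le> 101"
proof (cases "finite K")
  case False
  \<comment> \<open>An infinite set has \<open>card\<close> 0.\<close>
  then show ?thesis
    using assms by (simp add: proj_arc_def)
next
  case True
  have "\<forall>P\<in>K. \<exists>xe. P = point (fst xe) (snd xe)"
    using assms hpoints_eq_point unfolding proj_arc_def by (metis fst_conv snd_conv subsetD)
  then obtain g where g: "\<And>P. P \<in> K \<Longrightarrow> P = point (fst (g P)) (snd (g P))"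
    by metis
  have inj: "inj_on g K"
    using g by (metis inj_onI)
  have "card (g ` K) \<le> 101"
  proof (rule card_model_arc_le[OF \<sigma>_cases, where \<gamma> = "\<lambda>a x. carry a (coords x)"])
    fix a f
    have "{(x, e) \<in> g ` K. pg_inc x a \<and> dot (coords a) (offpivot x e) =
        dot (offpivot a f) (map3 \<sigma> (coords x)) + carry a (coords x)} \<subseteq> g ` {P \<in> K. P \<subseteq> line a f}"
    proof
      fix z
      assume z: "z \<in> {(x, e) \<in> g ` K. pg_inc x a \<and> dot (coords a) (offpivot x e) =
        dot (offpivot a f) (map3 \<sigma> (coords x)) + carry a (coords x)}"
      obtain x e where xe: "z = (x, e)" by (cases z)
      obtain P where P: "P \<in> K" "g P = (x, e)"
        using z xe by auto
      have "point x e \<subseteq> line a f"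
        using z xe by (intro point_subset_line) auto
      moreover have "P = point x e"
        using g[OF P(1)] P(2) by (metis fst_conv snd_conv)
      ultimately have "P \<in> {P \<in> K. P \<subseteq> line a f}"
        using P(1) by simp
      then show "z \<in> g ` {P \<in> K. P \<subseteq> line a f}"
        unfolding xe P(2)[symmetric] by (rule imageI)
    qed
    then have "card {(x, e) \<in> g ` K. pg_inc x a \<and> dot (coords a) (offpivot x e) =
        dot (offpivot a f) (map3 \<sigma> (coords x)) + carry a (coords x)} \<le> card (g ` {P \<in> K. P \<subseteq> line a f})"
      using True by (intro card_mono) auto
    also have "\<dots> \<le> card {P \<in> K. P \<subseteq> line a f}"
      using True by (intro card_image_le) auto
    also have "\<dots> \<le> 7"
      using assms line_mem_hlines unfolding proj_arc_def by blast
    finally show "card {(x, e) \<in> g ` K. pg_inc x a \<and> dot (coords a) (offpivot x e) =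
        dot (offpivot a f) (map3 \<sigma> (coords x)) + carry a (coords x)} \<le> 7" .
  qed
  then show ?thesis
    using assms card_image[OF inj] by (simp add: proj_arc_def)
qed

lemma max_arc_7_le: "max_arc 7 R \<le> 101"
proof -
  have "{k. \<exists>K. proj_arc R K k 7} \<subseteq> {..101}"
    using proj_arc_7_le by blast
  \<comment> \<open>\<open>Max\<close> needs a nonempty set; the empty arc supplies an
    element.\<close>
  moreover have "proj_arc R {} 0 7"
    by (simp add: proj_arc_def)
  ultimately show ?thesis
    unfolding max_arc_def by (subst Max_le_iff) (auto intro: finite_subset)
qed

end

section \<open>The three rings in coordinates\<close>

fun gf4_digits :: "gf4 \<Rightarrow> int \<times> int" where
  "gf4_digits G0 = (0, 0)"
| "gf4_digits G1 = (1, 0)"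
| "gf4_digits GW = (0, 1)"
| "gf4_digits GV = (1, 1)"

lemma gf4_digits_eq_iff: "gf4_digits a = gf4_digits b \<longleftrightarrow> a = b"
  by (cases a; cases b) simp_all

lemma gf4_digits_0_1: "gf4_digits 0 = (0, 0)" "gf4_digits 1 = (1, 0)"
  by (simp_all add: zero_gf4_def one_gf4_def)

lemma F4_eq: "F4 = range gf4_digits"
  by (auto simp: F4_def UNIV_gf4)

lemma gf4_digits_add: "f4_add (gf4_digits a) (gf4_digits b) = gf4_digits (a + b)"
  by (cases a; cases b) (simp_all add: f4_add_def zero_gf4_def)

lemma gf4_digits_mult: "f4_mul (gf4_digits a) (gf4_digits b) = gf4_digits (a * b)"
  by (cases a; cases b) (simp_all add: f4_mul_def)

lemma twisted_double_S4: "twisted_double_gf4 S4 (\<lambda>a b. (gf4_digits a, gf4_digits b)) (\<lambda>a. a) (\<lambda>_ _. 0) (\<lambda>_ _. 0)"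
  by standard (auto simp: S4_def F4_eq gf4_digits_eq_iff gf4_digits_add gf4_digits_mult gf4_digits_0_1)

lemma twisted_double_T4: "twisted_double_gf4 T4 (\<lambda>a b. (gf4_digits a, gf4_digits b)) (\<lambda>a. a * a) (\<lambda>_ _. 0) (\<lambda>_ _. 0)"
proof
  show "carrier T4 = {(gf4_digits a, gf4_digits b) | a b. True}"
    by (auto simp: T4_def F4_eq)
  show "(\<lambda>a::gf4. a * a) = (\<lambda>a. a) \<or> (\<lambda>a::gf4. a * a) = (\<lambda>a. a * a)"
    by (rule disjI2) (rule refl)
qed (simp_all add: T4_def gf4_digits_eq_iff gf4_digits_add gf4_digits_mult gf4_digits_0_1)

text \<open>In \<open>G4\<close> one has \<open>\<theta> = 2\<close> and the representatives \<open>0, 1, w, 1 + w\<close>, with \<open>w\<^sup>2 = (1 + w) + 2 (1 + w)\<close>,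
  \<open>w (1 + w) = 1 + 2\<close> and \<open>(1 + w)\<^sup>2 = w\<close>.\<close>

fun G4_add_carry :: "gf4 \<Rightarrow> gf4 \<Rightarrow> gf4" where
  "G4_add_carry G0 _ = G0"
| "G4_add_carry _ G0 = G0"
| "G4_add_carry G1 GW = G0"
| "G4_add_carry GW G1 = G0"
| "G4_add_carry GV b = b"
| "G4_add_carry a _ = a"

fun G4_mult_carry :: "gf4 \<Rightarrow> gf4 \<Rightarrow> gf4" where
  "G4_mult_carry GW GW = GV"
| "G4_mult_carry GW GV = G1"
| "G4_mult_carry GV GW = G1"
| "G4_mult_carry _ _ = G0"

definition G4_of :: "gf4 \<Rightarrow> gf4 \<Rightarrow> int \<times> int" where
  "G4_of a b = (fst (gf4_digits a) + 2 * fst (gf4_digits b), snd (gf4_digits a) + 2 * snd (gf4_digits b))"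

lemma twisted_double_G4: "twisted_double_gf4 G4 G4_of (\<lambda>a. a) G4_add_carry G4_mult_carry"
proof
  show "carrier G4 = {G4_of a b | a b. True}"
  proof -
    have "{G4_of a b | a b. True} = (\<lambda>(a, b). G4_of a b) ` ({G0, G1, GW, GV} \<times> {G0, G1, GW, GV})"
      unfolding UNIV_gf4[symmetric] image_def by fastforce
    moreover have "{0..3} = {0, 1, 2, 3::int}" by auto
    ultimately show ?thesis
      by (auto simp: G4_def G4_of_def)
  qed
  show "(G4_of a b = G4_of a' b') = (a = a' \<and> b = b')" for a b a' b'
    by (cases a; cases b; cases a'; cases b') (simp_all add: G4_of_def)
  show "\<zero>\<^bsub>G4\<^esub> = G4_of 0 0" "\<one>\<^bsub>G4\<^esub> = G4_of 1 0"
    by (simp_all add: G4_def G4_of_def zero_gf4_def one_gf4_def)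
  \<comment> \<open>The carry is the digitwise conjunction, as in binary addition.\<close>
  show "G4_of a b \<oplus>\<^bsub>G4\<^esub> G4_of a' b' = G4_of (a + a') (b + b' + G4_add_carry a a')" for a b a' b'
    by (cases a; cases b; cases a'; cases b') (simp_all add: G4_def G4_of_def zero_gf4_def)
  show "G4_of a b \<otimes>\<^bsub>G4\<^esub> G4_of a' b' = G4_of (a * a') (a * b' + b * a' + G4_mult_carry a a')"
    for a b a' b'
    by (cases a; cases b; cases a'; cases b') (simp_all add: G4_def G4_of_def zero_gf4_def)
  show "G4_add_carry a 0 = 0" "G4_add_carry 0 a = 0" "G4_mult_carry a 0 = 0" "G4_mult_carry 0 a = 0"
    "G4_mult_carry a 1 = 0" "G4_mult_carry 1 a = 0" for a
    by (cases a; simp add: zero_gf4_def one_gf4_def)+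
  show "a * G4_mult_carry b d + G4_mult_carry a (b * d)
      = G4_mult_carry a b * d + G4_mult_carry (a * b) d" for a b d
    by (cases a; cases b; cases d) (simp_all add: zero_gf4_def)
  show "G4_add_carry a b * d + G4_mult_carry (a + b) d
      = G4_mult_carry a d + G4_mult_carry b d + G4_add_carry (a * d) (b * d)" for a b d
    by (cases a; cases b; cases d) (simp_all add: zero_gf4_def)
qed simp

theorem theorem4p18:
  shows "max_arc 7 G4 \<le> 101 \<and> max_arc 7 S4 \<le> 101 \<and> max_arc 7 T4 \<le> 101"
  using twisted_double_G4 twisted_double_S4 twisted_double_T4
  by (simp add: twisted_double_gf4.max_arc_7_le)

end
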